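(* Let $f:\{0,1\}^n\times\{0,1\}^n\to\{-1,1\}$ be a total Boolean function. Then $BQC(f)=\Omega(H(\sigma^2(f))/\log n)$. Moreover, for $k\ge1$ let $\kappa_k=\sigma_1(f)+\cdots+\sigma_k(f)$. Then (asymptotically): if $\kappa_k\ge\Omega(\sqrt{k})$, then $BQC(f)=\Omega(\log\kappa_k)$; if $\kappa_k\le O(\sqrt{k})$, then \[BQC(f)=\Omega\!\left(\frac{\log\kappa_k}{\log(\sqrt{k})-\log\kappa_k+1}\right).\]
   Context: $M_f$ is the $2^n\times2^n$ matrix with entry $f(x,y)/2^n$ in row $x$, column $y$. $\sigma_1(f)\ge\sigma_2(f)\ge\cdots\ge\sigma_{2^n}(f)$ are the singular values of $M_f$ (their squares sum to 1), $\sigma^2(f)$ is the vector of their squares, and $H(\sigma^2(f))=-\sum_i\sigma_i(f)^2\log\sigma_i(f)^2$ (base 2, $0\log0=0$). Quantum communication model (Yao, no prior entanglement): Alice receives $x$, Bob $y$; each holds private qubits initialized to the input and $|0\rangle$; in each round one player applies a unitary to his qubits and sends one qubit; at the end a qubit is measured giving the output; cost is the number of qubits exchanged. $BQC(f)$ is the minimum cost of a protocol computing $f$ with error probability at most $1/3$ on every input. *)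

theory Defs
  imports "Jordan_Normal_Form.Char_Poly" "HOL-Library.Multiset"
begin

text \<open>Inputs x,y in {0,1}^n are encoded as natural numbers x,y < 2^n (bit i of x is the
  i-th input bit). f :: nat => nat => real is the Boolean function, only its values on
  x,y < 2^n matter.\<close>

definition Mf :: "nat \<Rightarrow> (nat \<Rightarrow> nat \<Rightarrow> real) \<Rightarrow> real mat" where
  "Mf n f = mat (2^n) (2^n) (\<lambda>(x,y). f x y / 2^n)"

text \<open>Squares of the singular values, with multiplicity: the eigenvalues
  (roots of the characteristic polynomial, with algebraic multiplicity) of M^T M.\<close>
definition sv2 :: "nat \<Rightarrow> (nat \<Rightarrow> nat \<Rightarrow> real) \<Rightarrow> real multiset" where
  "sv2 n f = proots (char_poly (transpose_mat (Mf n f) * Mf n f))"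

definition sv2_list :: "nat \<Rightarrow> (nat \<Rightarrow> nat \<Rightarrow> real) \<Rightarrow> real list" where
  "sv2_list n f = rev (sorted_list_of_multiset (sv2 n f))"

text \<open>sigma_i(f) for i = 1 .. 2^n (1-based indexing as in the paper).\<close>
definition sigma :: "nat \<Rightarrow> (nat \<Rightarrow> nat \<Rightarrow> real) \<Rightarrow> nat \<Rightarrow> real" where
  "sigma n f i = sqrt (sv2_list n f ! (i - 1))"

definition kappa :: "nat \<Rightarrow> (nat \<Rightarrow> nat \<Rightarrow> real) \<Rightarrow> nat \<Rightarrow> real" where
  "kappa n f k = (\<Sum>i=1..k. sigma n f i)"

definition entropy_sv :: "nat \<Rightarrow> (nat \<Rightarrow> nat \<Rightarrow> real) \<Rightarrow> real" where
  "entropy_sv n f = - (\<Sum>\<^sub># (image_mset (\<lambda>l. if l = 0 then 0 else l * log 2 l) (sv2 n f)))"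

section \<open>Quantum communication protocols (Yao model, no prior entanglement)\<close>

text \<open>An m-qubit system has computational basis states b :: nat => bool with b i = False
  for i >= m. States are complex amplitude functions on basis states, operators are
  complex kernels K b b'.\<close>

definition basis :: "nat \<Rightarrow> (nat \<Rightarrow> bool) set" where
  "basis m = {b. \<forall>i\<ge>m. \<not> b i}"

type_synonym qstate = "(nat \<Rightarrow> bool) \<Rightarrow> complex"
type_synonym qop = "(nat \<Rightarrow> bool) \<Rightarrow> (nat \<Rightarrow> bool) \<Rightarrow> complex"

definition apply_op :: "nat \<Rightarrow> qop \<Rightarrow> qstate \<Rightarrow> qstate" where
  "apply_op m K \<psi> = (\<lambda>b. \<Sum>b'\<in>basis m. K b b' * \<psi> b')"

text \<open>K is unitary on the 2^m dimensional space (U^* U = I; in finite dimension this is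
  equivalent to unitarity).\<close>
definition unitary_op :: "nat \<Rightarrow> qop \<Rightarrow> bool" where
  "unitary_op m K \<longleftrightarrow> (\<forall>b1\<in>basis m. \<forall>b2\<in>basis m.
      (\<Sum>b\<in>basis m. cnj (K b b1) * K b b2) = (if b1 = b2 then 1 else 0))"

definition restr :: "(nat \<Rightarrow> bool) \<Rightarrow> nat set \<Rightarrow> nat \<Rightarrow> bool" where
  "restr b S = (\<lambda>i. if i \<in> S then b i else False)"

text \<open>K acts only on the qubits in S, i.e. K = L (x) Id.\<close>
definition local_op :: "nat \<Rightarrow> nat set \<Rightarrow> qop \<Rightarrow> bool" where
  "local_op m S K \<longleftrightarrow> (\<exists>L :: qop. \<forall>b\<in>basis m. \<forall>b'\<in>basis m.
      K b b' = (if (\<forall>i. i \<notin> S \<longrightarrow> b i = b' i) then L (restr b S) (restr b' S) else 0))"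

text \<open>Ownership: own i = True means qubit i is held by Alice, False by Bob.
  A round (p, K, q): player p applies the unitary K to the qubits he holds and then
  sends his qubit q to the other player.\<close>
type_synonym round = "bool \<times> qop \<times> nat"

fun valid_rounds :: "nat \<Rightarrow> (nat \<Rightarrow> bool) \<Rightarrow> round list \<Rightarrow> bool" where
  "valid_rounds m own [] = True"
| "valid_rounds m own ((p, K, q) # rs) \<longleftrightarrow>
     unitary_op m K \<and> local_op m {i. i < m \<and> own i = p} K \<and> q < m \<and> own q = p \<and>
     valid_rounds m (own(q := \<not> p)) rs"

fun final_owner :: "(nat \<Rightarrow> bool) \<Rightarrow> round list \<Rightarrow> nat \<Rightarrow> bool" where
  "final_owner own [] = own"
| "final_owner own ((p, K, q) # rs) = final_owner (own(q := \<not> p)) rs"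

fun evolve :: "nat \<Rightarrow> round list \<Rightarrow> qstate \<Rightarrow> qstate" where
  "evolve m [] \<psi> = \<psi>"
| "evolve m ((p, K, q) # rs) \<psi> = evolve m rs (apply_op m K \<psi>)"

text \<open>A protocol: m qubits in total; qubits 0..n-1 hold Alice's input x, qubits n..2n-1
  hold Bob's input y, qubits 2n..m-1 are ancillas initialized to |0>, distributed between
  the players by own0; a list of rounds; at the end the holder p of the output qubit
  may apply a last local unitary Kf and measures qubit out in the computational basis.\<close>
record protocol =
  nqubits :: nat
  own0 :: "nat \<Rightarrow> bool"
  rounds :: "round list"
  fin_player :: bool
  fin_op :: qop
  out_qubit :: nat

definition valid_protocol :: "nat \<Rightarrow> protocol \<Rightarrow> bool" where
  "valid_protocol n P \<longleftrightarrow>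
     (let m = nqubits P; own' = final_owner (own0 P) (rounds P) in
      2 * n \<le> m \<and> (\<forall>i<n. own0 P i) \<and> (\<forall>i. n \<le> i \<and> i < 2 * n \<longrightarrow> \<not> own0 P i) \<and>
      valid_rounds m (own0 P) (rounds P) \<and>
      unitary_op m (fin_op P) \<and> local_op m {i. i < m \<and> own' i = fin_player P} (fin_op P) \<and>
      out_qubit P < m \<and> own' (out_qubit P) = fin_player P)"

definition init_basis :: "nat \<Rightarrow> nat \<Rightarrow> nat \<Rightarrow> nat \<Rightarrow> bool" where
  "init_basis n x y = (\<lambda>i. if i < n then bit x i else if i < 2 * n then bit y (i - n) else False)"

definition init_state :: "nat \<Rightarrow> nat \<Rightarrow> nat \<Rightarrow> qstate" where
  "init_state n x y = (\<lambda>b. if b = init_basis n x y then 1 else 0)"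

definition final_state :: "nat \<Rightarrow> protocol \<Rightarrow> nat \<Rightarrow> nat \<Rightarrow> qstate" where
  "final_state n P x y =
     apply_op (nqubits P) (fin_op P) (evolve (nqubits P) (rounds P) (init_state n x y))"

definition prob_out :: "nat \<Rightarrow> protocol \<Rightarrow> nat \<Rightarrow> nat \<Rightarrow> bool \<Rightarrow> real" where
  "prob_out n P x y c =
     (\<Sum>b\<in>{b \<in> basis (nqubits P). b (out_qubit P) = c}. (cmod (final_state n P x y b))\<^sup>2)"

text \<open>Measurement outcome c encodes the value (-1)^c, i.e. True means -1.
  The protocol computes f with error at most 1/3 on every input.\<close>
definition computes :: "nat \<Rightarrow> (nat \<Rightarrow> nat \<Rightarrow> real) \<Rightarrow> protocol \<Rightarrow> bool" where
  "computes n f P \<longleftrightarrow> valid_protocol n P \<and>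
     (\<forall>x<2^n. \<forall>y<2^n. prob_out n P x y (f x y = -1) \<ge> 2/3)"

definition BQC :: "nat \<Rightarrow> (nat \<Rightarrow> nat \<Rightarrow> real) \<Rightarrow> nat" where
  "BQC n f = (LEAST c. \<exists>P. computes n f P \<and> length (rounds P) = c)"

definition boolean_fun :: "nat \<Rightarrow> (nat \<Rightarrow> nat \<Rightarrow> real) \<Rightarrow> bool" where
  "boolean_fun n f \<longleftrightarrow> (\<forall>x<2^n. \<forall>y<2^n. f x y = 1 \<or> f x y = -1)"

end

theory Submission
  imports Defs "Jordan_Normal_Form.Schur_Decomposition"
begin

text \<open>
  After \<open>c\<close> qubits of communication the joint final state is a sum of \<open>2^c\<close> products of a vector
  depending only on Alice's input and a vector depending only on Bob's (Yao, Kremer). Hence the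
  matrices of output probabilities have complex rank at most \<open>4^c\<close>. Applying the
  majority-of-\<open>2m\<close> polynomial entrywise to these matrices reduces the error to \<open>2 (8/9)^m\<close> and
  raises the rank only to \<open>2^O(c m)\<close>. So \<open>M_f\<close> is within \<open>2 (8/9)^m\<close> in Frobenius norm of a
  matrix of rank \<open>r = 2^O(c m)\<close>, and by Eckart-Young the squared singular values beyond the first
  \<open>r\<close> sum to at most \<open>4 (64/81)^m\<close>. With \<open>m\<close> of order \<open>log n\<close> the tail contributes \<open>O(1)\<close> to
  the entropy and the head at most \<open>log r\<close>. For \<open>\<kappa>_k\<close>, Cauchy-Schwarz on head and tail gives
  \<open>\<kappa>_k \<le> sqrt r + 2 (8/9)^m sqrt k\<close>, and \<open>m\<close> of order \<open>log (sqrt k / \<kappa>_k) + 1\<close> makes the second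
  term at most \<open>\<kappa>_k / 2\<close>. All additive constants are absorbed when \<open>c \<ge> 1\<close>. When \<open>c = 0\<close> the
  matrix \<open>M_f\<close> has rank one, so the entropy vanishes and \<open>\<kappa>_k \<le> 1\<close>.
\<close>

section \<open>Real symmetric matrices\<close>

text \<open>Over the complex numbers the polynomial splits. For an eigenvector \<open>v\<close> the
  Hermitian form \<open>S\<close> equals both \<open>a * of_real R\<close> with \<open>R > 0\<close>
  and its own conjugate, so every root is real. The factorization then descends along the injective
  embedding of the coefficients.\<close>

lemma real_symmetric_char_poly_splits:
  fixes A :: "real mat"
  assumes A: "A \<in> carrier_mat n n" and sym: "transpose_mat A = A"
  shows "\<exists>es. char_poly A = (\<Prod>e\<leftarrow>es. [:- e, 1:])"
proof -
  define C where "C = map_mat complex_of_real A"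
  have C: "C \<in> carrier_mat n n" using A by (simp add: C_def)
  have Aij: "A $$ (i, j) = A $$ (j, i)" if "i < n" "j < n" for i j
    using arg_cong[OF sym, of "\<lambda>M. M $$ (i, j)"] that A by simp
  obtain as where as: "char_poly C = (\<Prod>a\<leftarrow>as. [:- a, 1:])"
    using char_poly_factorized[OF C] by blast
  have real: "a = complex_of_real (Re a)" if "a \<in> set as" for a
  proof -
    have "poly (char_poly C) a = 0"
      unfolding as poly_prod_list using that by (auto simp: prod_list_zero_iff)
    then obtain v where v: "eigenvector C v a"
      using eigenvalue_root_char_poly[OF C] unfolding eigenvalue_def by blast
    then have vc: "v \<in> carrier_vec n" and v0: "v \<noteq> 0\<^sub>v n" and ev: "C *\<^sub>v v = a \<cdot>\<^sub>v v"
      using C by (auto simp: eigenvector_def)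
    have evi: "(\<Sum>j<n. of_real (A $$ (i, j)) * v $ j) = a * v $ i" if "i < n" for i
      using arg_cong[OF ev, of "\<lambda>w. w $ i"] that A vc
      by (simp add: C_def scalar_prod_def lessThan_atLeast0)
    define S where "S = (\<Sum>i<n. \<Sum>j<n. cnj (v $ i) * of_real (A $$ (i, j)) * v $ j)"
    define R where "R = (\<Sum>i<n. (cmod (v $ i))\<^sup>2)"
    have S1: "S = a * of_real R"
    proof -
      have "S = (\<Sum>i<n. cnj (v $ i) * (a * v $ i))"
        unfolding S_def
        by (intro sum.cong refl) (simp add: evi[symmetric] sum_distrib_left mult.assoc)
      also have "\<dots> = a * of_real R"
        unfolding R_def of_real_sum sum_distrib_left complex_norm_square
        by (intro sum.cong refl) (simp add: mult_ac)
      finally show ?thesis .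
    qed
    have S2: "cnj S = S"
    proof -
      have "cnj S = (\<Sum>i<n. \<Sum>j<n. v $ i * of_real (A $$ (i, j)) * cnj (v $ j))"
        by (simp add: S_def)
      also have "\<dots> = (\<Sum>j<n. \<Sum>i<n. v $ i * of_real (A $$ (i, j)) * cnj (v $ j))"
        by (rule sum.swap)
      also have "\<dots> = S"
        unfolding S_def by (intro sum.cong refl) (auto simp: Aij mult_ac)
      finally show ?thesis .
    qed
    obtain k where k: "k < n" "v $ k \<noteq> 0"
      using v0 vc by (metis carrier_vecD eq_vecI index_zero_vec)
    have "(cmod (v $ k))\<^sup>2 \<le> R"
      unfolding R_def using k by (intro member_le_sum) auto
    moreover have "0 < (cmod (v $ k))\<^sup>2" using k by simp
    ultimately have "R > 0" by linarith
    then have "cnj a = a" using S1 S2 by simp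
    then show ?thesis by (metis Reals_cnj_iff of_real_Re)
  qed
  define es where "es = map Re as"
  have as_es: "as = map complex_of_real es"
    unfolding es_def by (simp add: o_def) (metis map_idI real)
  interpret h: map_poly_inj_comm_ring_hom complex_of_real ..
  have "map_poly complex_of_real (char_poly A) = char_poly C"
    unfolding C_def by (simp add: of_real_hom.char_poly_hom[OF A])
  also have "\<dots> = map_poly complex_of_real (\<Prod>e\<leftarrow>es. [:- e, 1:])"
    unfolding as as_es h.hom_prod_list by (simp add: o_def)
  finally have "char_poly A = (\<Prod>e\<leftarrow>es. [:- e, 1:])"
    by (rule h.injectivity)
  then show ?thesis by blast
qed

text \<open>Provides the rotation for the deflation step below. Gram-Schmidt keeps the head of its
  input, so a basis completion headed by \<open>v\<close> yields, after normalization, a first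
  column parallel to \<open>v\<close>.\<close>

lemma orthonormal_completion:
  fixes v :: "real vec"
  assumes v: "v \<in> carrier_vec n" "v \<noteq> 0\<^sub>v n"
  shows "\<exists>W\<in>carrier_mat n n. transpose_mat W * W = 1\<^sub>m n \<and> (\<exists>c. col W 0 = c \<cdot>\<^sub>v v)"
proof -
  interpret cof_vec_space n "TYPE(real)" .
  define b where "b = basis_completion v"
  define ws where "ws = gram_schmidt n b"
  have n: "n > 0" using v by (metis carrier_vecD eq_vecI gr_zeroI index_zero_vec(2) not_less_zero)
  from basis_completion[OF v, folded b_def]
  have dist_b: "distinct b" and indep: "\<not> lin_dep (set b)" and b: "set b \<subseteq> carrier_vec n"
    and hdb: "hd b = v" and len_b: "length b = n" by auto
  from hdb len_b n obtain vs where bv: "b = v # vs" by (cases b) auto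
  from gram_schmidt_result[OF b dist_b indep refl, folded ws_def]
  have ws: "set ws \<subseteq> carrier_vec n" "corthogonal ws" "length ws = n"
    by (auto simp: len_b)
  have wi: "ws ! i \<in> carrier_vec n" if "i < n" for i using ws that by (metis nth_mem subsetD)
  have hdws: "ws ! 0 = v"
    using gram_schmidt_hd[OF v(1), of vs, folded bv] ws(3) n unfolding ws_def
    by (metis hd_conv_nth length_greater_0_conv)
  define c where "c i = 1 / sqrt (ws ! i \<bullet> ws ! i)" for i
  define W where "W = mat n n (\<lambda>(x, i). c i * ws ! i $ x)"
  have W: "W \<in> carrier_mat n n" by (simp add: W_def)
  have conj: "conjugate u = u" for u :: "real vec"
    by (rule eq_vecI) auto
  have orth: "(ws ! i \<bullet> ws ! j = 0) = (i \<noteq> j)" if "i < n" "j < n" for i j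
    using corthogonalD[OF ws(2)] that ws(3) by (simp add: conj)
  have pos: "ws ! i \<bullet> ws ! i > 0" if "i < n" for i
  proof -
    have "ws ! i \<bullet> ws ! i \<ge> 0" by (auto simp: scalar_prod_def intro: sum_nonneg)
    then show ?thesis using orth[of i i] that by auto
  qed
  have "transpose_mat W * W = 1\<^sub>m n"
  proof (rule eq_matI)
    fix i j assume ij: "i < dim_row (1\<^sub>m n)" "j < dim_col (1\<^sub>m n)"
    then have i: "i < n" and j: "j < n" by auto
    have "(transpose_mat W * W) $$ (i, j) = (\<Sum>x = 0..<n. (c i * ws ! i $ x) * (c j * ws ! j $ x))"
      using i j by (simp add: W_def scalar_prod_def)
    also have "\<dots> = c i * c j * (ws ! i \<bullet> ws ! j)"
      using wi[OF j] by (simp add: scalar_prod_def sum_distrib_left mult_ac)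
    also have "\<dots> = (if i = j then 1 else 0)"
      using orth[OF i j] pos[OF i] by (auto simp: c_def)
    finally show "(transpose_mat W * W) $$ (i, j) = 1\<^sub>m n $$ (i, j)" using i j by simp
  qed (auto simp: W_def)
  moreover have "col W 0 = c 0 \<cdot>\<^sub>v v"
    using n v by (intro eq_vecI) (auto simp: W_def hdws)
  ultimately show ?thesis using W by blast
qed


text \<open>Deflation, by induction on the eigenvalue list. Rotating an eigenvector to the first
  coordinate clears the first column off the diagonal, symmetry clears the first row, and the
  remaining block is symmetric with the factor of \<open>e\<close> removed. The diagonal follows the
  order of the given list, so it can later be the sorted one.\<close>

lemma real_symmetric_diagonalization:
  fixes A :: "real mat"
  assumes "A \<in> carrier_mat n n" "transpose_mat A = A" "char_poly A = (\<Prod>e\<leftarrow>es. [:- e, 1:])"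
  shows "\<exists>U\<in>carrier_mat n n. transpose_mat U * U = 1\<^sub>m n \<and>
           transpose_mat U * A * U = mat n n (\<lambda>(i, j). if i = j then es ! i else 0)"
  using assms
proof (induction es arbitrary: n A)
  case Nil
  then have "n = 0" using degree_monic_char_poly[of A n] by auto
  then show ?case using Nil by (intro bexI[of _ "1\<^sub>m 0"]) auto
next
  case (Cons e es n A)
  note A = Cons.prems(1) and sym = Cons.prems(2)
  have cp: "char_poly A = [:- e, 1:] * (\<Prod>e\<leftarrow>es. [:- e, 1:])" using Cons.prems(3) by simp
  have "poly (char_poly A) e = 0" unfolding cp by simp
  then obtain v where "eigenvector A v e"
    using eigenvalue_root_char_poly[OF A] unfolding eigenvalue_def by blast
  then have v: "v \<in> carrier_vec n" "v \<noteq> 0\<^sub>v n" and ev: "A *\<^sub>v v = e \<cdot>\<^sub>v v"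
    using A by (auto simp: eigenvector_def)
  have n: "n > 0" using v by (metis carrier_vecD eq_vecI gr_zeroI index_zero_vec(2) not_less_zero)
  then obtain k where k: "n = Suc k" by (cases n) auto
  obtain W c where W: "W \<in> carrier_mat n n" and WW: "transpose_mat W * W = 1\<^sub>m n"
    and W0: "col W 0 = c \<cdot>\<^sub>v v"
    using orthonormal_completion[OF v] by blast
  define B where "B = transpose_mat W * A * W"
  have B: "B \<in> carrier_mat n n" using W A by (simp add: B_def)
  have WW': "W * transpose_mat W = 1\<^sub>m n"
    using mat_mult_left_right_inverse[OF _ W WW] W by simp
  have simil: "similar_mat B A"
    unfolding similar_mat_def similar_mat_wit_def Let_def
    by (rule exI[of _ "transpose_mat W"], rule exI[of _ W]) (use W A B WW WW' in \<open>auto simp: B_def\<close>)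
  have symB: "transpose_mat B = B"
    unfolding B_def using W A sym
    by (simp add: transpose_mult[of _ n n _ n] assoc_mult_mat[of _ n n _ n _ n])
  have Bij: "B $$ (i, j) = B $$ (j, i)" if "i < n" "j < n" for i j
    using arg_cong[OF symB, of "\<lambda>M. M $$ (i, j)"] that B by simp
  \<comment> \<open>The first column of \<open>W\<close> is an eigenvector, so the first column of
    \<open>B\<close> is \<open>e\<close> times that of \<open>transpose_mat W * W\<close>, the
    identity.\<close>
  have Bi0: "B $$ (i, 0) = (if i = 0 then e else 0)" if i: "i < n" for i
  proof -
    have "A *\<^sub>v col W 0 = e \<cdot>\<^sub>v col W 0"
      unfolding W0 using A v ev by (simp add: mult_mat_vec smult_smult_assoc mult.commute)
    then have "col (A * W) 0 = e \<cdot>\<^sub>v col W 0" unfolding col_mult2[OF A W n] .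
    moreover have "B = transpose_mat W * (A * W)"
      using A W by (simp add: B_def assoc_mult_mat[of _ n n _ n _ n])
    ultimately have "B $$ (i, 0) = e * (transpose_mat W * W) $$ (i, 0)"
      using i n A W by simp
    then show ?thesis unfolding WW using i n by simp
  qed
  define D where "D = mat k k (\<lambda>(i, j). B $$ (Suc i, Suc j))"
  define E where "E = mat 1 1 (\<lambda>_. e)"
  have D: "D \<in> carrier_mat k k" by (simp add: D_def)
  have E: "E \<in> carrier_mat 1 1" by (simp add: E_def)
  have Bblock: "B = four_block_mat E (0\<^sub>m 1 k) (0\<^sub>m k 1) D"
    by (rule eq_matI) (use B k Bi0 Bij in \<open>auto simp: D_def E_def\<close>)
  have symD: "transpose_mat D = D"
    by (rule eq_matI) (use Bij k in \<open>auto simp: D_def\<close>)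
  have cpE: "char_poly E = [:- e, 1:]"
    by (simp add: E_def char_poly_defs det_def sign_def)
  have "char_poly B = char_poly E * char_poly D"
    unfolding Bblock by (rule char_poly_four_block_zeros_col[OF E _ D]) simp
  then have "[:- e, 1:] * char_poly D = [:- e, 1:] * (\<Prod>e\<leftarrow>es. [:- e, 1:])"
    using char_poly_similar[OF simil] cp cpE by simp
  then have "char_poly D = (\<Prod>e\<leftarrow>es. [:- e, 1:])"
    by (metis mult_cancel_left pCons_eq_0_iff zero_neq_one)
  from Cons.IH[OF D symD this] obtain V where V: "V \<in> carrier_mat k k"
    and VV: "transpose_mat V * V = 1\<^sub>m k"
    and VD: "transpose_mat V * D * V = mat k k (\<lambda>(i, j). if i = j then es ! i else 0)" by blast
  define G where "G = four_block_mat (1\<^sub>m 1) (0\<^sub>m 1 k) (0\<^sub>m k 1) V"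
  have G: "G \<in> carrier_mat n n" unfolding G_def k using V by auto
  have GT: "transpose_mat G = four_block_mat (1\<^sub>m 1) (0\<^sub>m 1 k) (0\<^sub>m k 1) (transpose_mat V)"
    unfolding G_def using V
    by (subst transpose_four_block_mat[of _ 1 1 _ k _ k]) (auto simp: zero_transpose_mat)
  have GG: "transpose_mat G * G = 1\<^sub>m n"
  proof -
    have "transpose_mat G * G = four_block_mat (1\<^sub>m 1) (0\<^sub>m 1 k) (0\<^sub>m k 1) (1\<^sub>m k)"
      unfolding GT unfolding G_def using V VV
      by (subst mult_four_block_mat[of _ 1 1 _ k _ k _ _ 1 _ k]) auto
    then show ?thesis by (auto simp: k)
  qed
  have GB: "transpose_mat G * B * G =
      four_block_mat E (0\<^sub>m 1 k) (0\<^sub>m k 1) (transpose_mat V * D * V)"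
  proof -
    have 1: "transpose_mat G * B = four_block_mat E (0\<^sub>m 1 k) (0\<^sub>m k 1) (transpose_mat V * D)"
      unfolding GT Bblock using V D E
      by (subst mult_four_block_mat[of _ 1 1 _ k _ k _ _ 1 _ k]) auto
    show ?thesis
      unfolding 1 unfolding G_def using V D E
      by (subst mult_four_block_mat[of _ 1 1 _ k _ k _ _ 1 _ k]) auto
  qed
  define U where "U = W * G"
  have U: "U \<in> carrier_mat n n" using W G by (simp add: U_def)
  have UT: "transpose_mat U = transpose_mat G * transpose_mat W"
    unfolding U_def using W G by (simp add: transpose_mult[of _ n n _ n])
  have "transpose_mat U * U = transpose_mat G * (transpose_mat W * W) * G"
    unfolding UT unfolding U_def using W G by (simp add: assoc_mult_mat[of _ n n _ n _ n])
  then have UU: "transpose_mat U * U = 1\<^sub>m n" using WW GG G by simp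
  have "transpose_mat U * A * U = transpose_mat G * B * G"
    unfolding UT unfolding U_def B_def using W G A by (simp add: assoc_mult_mat[of _ n n _ n _ n])
  also have "\<dots> = mat n n (\<lambda>(i, j). if i = j then (e # es) ! i else 0)"
    unfolding GB VD k E_def by (rule eq_matI) (auto simp: nth_Cons')
  finally show ?case using U UU by blast
qed

section \<open>Low-rank approximation and singular values\<close>

lemma sum_lessThan_add: "(\<Sum>i<r + k. g i) = (\<Sum>i<r. g i) + (\<Sum>i<k. g (r + i))"
  for g :: "nat \<Rightarrow> 'a::comm_monoid_add"
  by (induction k) (auto simp: add.assoc)

text \<open>The pair (i, j) is coded as k = i * s + j. This indexes the product of an expansion into
  \<open>r\<close> terms with one into \<open>s\<close> terms.\<close>

lemma sum_lessThan_mult: "(\<Sum>k<r * s. g (k div s) (k mod s)) = (\<Sum>i<r. \<Sum>j<s. g i j)"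
  for g :: "nat \<Rightarrow> nat \<Rightarrow> 'a::comm_monoid_add"
proof (induction r)
  case (Suc r)
  have "Suc r * s = r * s + s" by simp
  then have "(\<Sum>k<Suc r * s. g (k div s) (k mod s))
      = (\<Sum>k<r * s. g (k div s) (k mod s)) + (\<Sum>j<s. g ((r * s + j) div s) ((r * s + j) mod s))"
    by (simp only: sum_lessThan_add)
  also have "(\<Sum>j<s. g ((r * s + j) div s) ((r * s + j) mod s)) = (\<Sum>j<s. g r j)"
    by (intro sum.cong) auto
  finally show ?case using Suc by simp
qed simp

section \<open>Orthonormal families, projection and Gram-Schmidt for real functions on an initial
  segment\<close>

definition dot :: "nat \<Rightarrow> (nat \<Rightarrow> real) \<Rightarrow> (nat \<Rightarrow> real) \<Rightarrow> real" where
  "dot N u v = (\<Sum>y<N. u y * v y)"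

definition orthonormal :: "nat \<Rightarrow> nat \<Rightarrow> (nat \<Rightarrow> nat \<Rightarrow> real) \<Rightarrow> bool" where
  "orthonormal N s q \<longleftrightarrow> (\<forall>i<s. \<forall>j<s. dot N (q i) (q j) = (if i = j then 1 else 0))"

lemma dot_commute: "dot N u v = dot N v u"
  by (simp add: dot_def mult.commute)

lemma dot_sum_right: "dot N u (\<lambda>y. \<Sum>j\<in>J. d j * q j y) = (\<Sum>j\<in>J. d j * dot N u (q j))"
proof -
  have "dot N u (\<lambda>y. \<Sum>j\<in>J. d j * q j y) = (\<Sum>y<N. \<Sum>j\<in>J. d j * (u y * q j y))"
    by (simp add: dot_def sum_distrib_left mult_ac)
  also have "\<dots> = (\<Sum>j\<in>J. \<Sum>y<N. d j * (u y * q j y))" by (rule sum.swap)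
  finally show ?thesis by (simp add: dot_def sum_distrib_left)
qed

lemma dot_diff_self:
  "dot N (\<lambda>y. u y - v y) (\<lambda>y. u y - v y) = dot N u u - 2 * dot N u v + dot N v v"
  by (simp add: dot_def algebra_simps sum.distrib sum_subtractf sum_distrib_left)

lemma dot_self_nonneg: "0 \<le> dot N u u"
  by (simp add: dot_def sum_nonneg)

lemma dot_orthonormal_comb:
  assumes "orthonormal N s q"
  shows "dot N (\<lambda>y. \<Sum>j<s. d j * q j y) (\<lambda>y. \<Sum>j<s. d j * q j y) = (\<Sum>j<s. (d j)\<^sup>2)"
proof -
  have "dot N (\<lambda>y. \<Sum>j<s. d j * q j y) (q i) = d i" if "i < s" for i
  proof -
    have "dot N (\<lambda>y. \<Sum>j<s. d j * q j y) (q i) = (\<Sum>j<s. d j * dot N (q i) (q j))"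
      by (subst dot_commute) (rule dot_sum_right)
    also have "\<dots> = (\<Sum>j<s. if j = i then d j else 0)"
      using assms that by (intro sum.cong) (auto simp: orthonormal_def)
    finally show ?thesis using that by simp
  qed
  then show ?thesis by (simp add: dot_sum_right power2_eq_square)
qed

text \<open>Completing the square: the two sides differ by the sum of all
  \<open>(d j - dot N u (q j))\<^sup>2\<close>, so orthogonal projection is the best
  approximation.\<close>

lemma orthonormal_residual:
  assumes "orthonormal N s q"
  shows "dot N u u - (\<Sum>j<s. (dot N u (q j))\<^sup>2)
    \<le> dot N (\<lambda>y. u y - (\<Sum>j<s. d j * q j y)) (\<lambda>y. u y - (\<Sum>j<s. d j * q j y))"
proof -
  have "dot N (\<lambda>y. u y - (\<Sum>j<s. d j * q j y)) (\<lambda>y. u y - (\<Sum>j<s. d j * q j y))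
     = dot N u u - 2 * (\<Sum>j<s. d j * dot N u (q j)) + (\<Sum>j<s. (d j)\<^sup>2)"
    unfolding dot_diff_self unfolding dot_orthonormal_comb[OF assms] unfolding dot_sum_right ..
  moreover have "0 \<le> (\<Sum>j<s. (d j - dot N u (q j))\<^sup>2)" by (simp add: sum_nonneg)
  moreover have "(\<Sum>j<s. (d j - dot N u (q j))\<^sup>2)
      = (\<Sum>j<s. (d j)\<^sup>2) - 2 * (\<Sum>j<s. d j * dot N u (q j)) + (\<Sum>j<s. (dot N u (q j))\<^sup>2)"
    by (simp add: power2_diff sum.distrib sum_subtractf sum_distrib_left mult.assoc)
  ultimately show ?thesis by linarith
qed

lemma bessel_inequality:
  assumes "orthonormal N s q"
  shows "(\<Sum>j<s. (dot N u (q j))\<^sup>2) \<le> dot N u u"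
proof -
  have "dot N u u - 2 * (\<Sum>j<s. dot N u (q j) * dot N u (q j)) + (\<Sum>j<s. (dot N u (q j))\<^sup>2) \<ge> 0"
    by (rule dot_self_nonneg[of N "\<lambda>y. u y - (\<Sum>j<s. dot N u (q j) * q j y)",
          unfolded dot_diff_self, unfolded dot_orthonormal_comb[OF assms], unfolded dot_sum_right])
  then show ?thesis by (simp add: power2_eq_square)
qed

text \<open>The given functions may be linearly dependent. One whose residual \<open>z\<close>
  vanishes adds no new member to the family, hence \<open>s\<close> can be smaller than
  \<open>r\<close>.\<close>

lemma gram_schmidt_functions:
  fixes v :: "nat \<Rightarrow> nat \<Rightarrow> real"
  shows "\<exists>s\<le>r. \<exists>q c. orthonormal N s q \<and> (\<forall>i<r. \<forall>y<N. v i y = (\<Sum>j<s. c i j * q j y))"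
proof (induction r)
  case 0
  show ?case by (auto simp: orthonormal_def)
next
  case (Suc r)
  then obtain s q c where s: "s \<le> r" and q: "orthonormal N s q"
    and c: "\<And>i y. i < r \<Longrightarrow> y < N \<Longrightarrow> v i y = (\<Sum>j<s. c i j * q j y)" by blast
  define z where "z y = v r y - (\<Sum>j<s. dot N (v r) (q j) * q j y)" for y
  have zq: "dot N z (q i) = 0" if "i < s" for i
  proof -
    have "dot N z (q i) = dot N (q i) (v r) - dot N (q i) (\<lambda>y. \<Sum>j<s. dot N (v r) (q j) * q j y)"
      by (simp add: z_def dot_def algebra_simps sum_subtractf)
    also have "dot N (q i) (\<lambda>y. \<Sum>j<s. dot N (v r) (q j) * q j y)
        = (\<Sum>j<s. if j = i then dot N (v r) (q j) else 0)"
      unfolding dot_sum_right using q that by (intro sum.cong) (auto simp: orthonormal_def)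
    finally show ?thesis using that by (simp add: dot_commute)
  qed
  show ?case
  proof (cases "dot N z z = 0")
    case True
    then have "z y = 0" if "y < N" for y
      using that by (auto simp: dot_def sum_nonneg_eq_0_iff)
    then have "v r y = (\<Sum>j<s. dot N (v r) (q j) * q j y)" if "y < N" for y
      using that by (auto simp: z_def)
    then have "\<forall>i<Suc r. \<forall>y<N. v i y = (\<Sum>j<s. (c(r := \<lambda>j. dot N (v r) (q j))) i j * q j y)"
      using c by (auto simp: less_Suc_eq)
    then show ?thesis using q s by (meson le_SucI)
  next
    case False
    then have pos: "dot N z z > 0" using dot_self_nonneg[of N z] by linarith
    define n where "n = sqrt (dot N z z)"
    have n: "n > 0" "n * n = dot N z z" using pos by (auto simp: n_def)
    define q' where "q' = q(s := \<lambda>y. z y / n)"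
    define c' where "c' i j = (if i = r then if j = s then n else dot N (v r) (q j)
        else if j = s then 0 else c i j)" for i j
    have "orthonormal N (Suc s) q'"
    proof -
      have a: "dot N (\<lambda>y. z y / n) (q i) = 0" "dot N (q i) (\<lambda>y. z y / n) = 0" if "i < s" for i
        using zq[OF that] by (simp_all add: dot_def sum_divide_distrib[symmetric] mult.commute)
      have "dot N (\<lambda>y. z y / n) (\<lambda>y. z y / n) = dot N z z / (n * n)"
        by (simp add: dot_def sum_divide_distrib)
      also have "\<dots> = 1" using n pos by simp
      finally show ?thesis
        using q a by (auto simp: orthonormal_def q'_def less_Suc_eq)
    qed
    moreover have "v i y = (\<Sum>j<Suc s. c' i j * q' j y)" if "i < Suc r" "y < N" for i y
      using that c[of i y] s n by (cases "i = r") (auto simp: c'_def q'_def z_def)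
    ultimately show ?thesis using s by (meson Suc_le_mono)
  qed
qed

text \<open>A fractional knapsack: it is best to fill the \<open>r\<close> largest values. The
  weight at positions from \<open>r\<close> on is worth at most \<open>l r\<close> per unit and fits
  into the room left in the first \<open>r\<close> positions, where each unit is worth at least
  \<open>l r\<close>.\<close>

lemma weighted_sum_le_head:
  fixes l c :: "nat \<Rightarrow> real"
  assumes mono: "\<And>i j. i \<le> j \<Longrightarrow> j < N \<Longrightarrow> l j \<le> l i" and l: "\<And>i. i < N \<Longrightarrow> 0 \<le> l i"
    and c: "\<And>i. i < N \<Longrightarrow> 0 \<le> c i \<and> c i \<le> 1" and sum: "(\<Sum>i<N. c i) \<le> real r"
  shows "(\<Sum>i<N. l i * c i) \<le> (\<Sum>i<min r N. l i)"
proof (cases "r < N")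
  case False
  then have "min r N = N" by simp
  then show ?thesis using l c by (auto intro!: sum_mono mult_left_le)
next
  case True
  have split: "(\<Sum>i<N. g i) = (\<Sum>i<r. g i) + (\<Sum>i=r..<N. g i)" for g :: "nat \<Rightarrow> real"
    using True by (metis atLeast0LessThan less_imp_le_nat sum.atLeastLessThan_concat zero_le)
  have "(\<Sum>i=r..<N. l i * c i) \<le> (\<Sum>i=r..<N. l r * c i)"
    using mono c by (intro sum_mono mult_right_mono) auto
  also have "\<dots> = l r * (\<Sum>i=r..<N. c i)" by (simp add: sum_distrib_left)
  also have "\<dots> \<le> l r * (\<Sum>i<r. 1 - c i)"
    using sum True l[of r] unfolding split by (intro mult_left_mono) (auto simp: sum_subtractf)
  also have "\<dots> = (\<Sum>i<r. l r * (1 - c i))" by (simp add: sum_distrib_left)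
  also have "\<dots> \<le> (\<Sum>i<r. l i * (1 - c i))"
    using mono c True by (intro sum_mono mult_right_mono) auto
  also have "\<dots> = (\<Sum>i<r. l i) - (\<Sum>i<r. l i * c i)"
    by (simp add: algebra_simps sum_subtractf)
  finally show ?thesis using True unfolding split by (simp add: min_def)
qed

section \<open>Upper bounds on rank and their behaviour under entrywise operations\<close>

definition has_rank :: "nat \<Rightarrow> nat \<Rightarrow> (nat \<Rightarrow> nat \<Rightarrow> 'a::comm_semiring_1) \<Rightarrow> bool" where
  "has_rank N r F \<longleftrightarrow> (\<exists>u v. \<forall>x<N. \<forall>y<N. F x y = (\<Sum>i<r. u i x * v i y))"

lemma has_rank_add:
  assumes "has_rank N r F" "has_rank N s G"
  shows "has_rank N (r + s) (\<lambda>x y. F x y + G x y)"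
proof -
  obtain u v u' v' where
    "\<And>x y. x < N \<Longrightarrow> y < N \<Longrightarrow> F x y = (\<Sum>i<r. u i x * v i y)"
    "\<And>x y. x < N \<Longrightarrow> y < N \<Longrightarrow> G x y = (\<Sum>i<s. u' i x * v' i y)"
    using assms unfolding has_rank_def by blast
  then have "\<forall>x<N. \<forall>y<N. F x y + G x y = (\<Sum>i<r + s.
      (if i < r then u i else u' (i - r)) x * (if i < r then v i else v' (i - r)) y)"
    by (simp add: sum_lessThan_add)
  then show ?thesis unfolding has_rank_def
    by (intro exI[of _ "\<lambda>i. if i < r then u i else u' (i - r)"]
        exI[of _ "\<lambda>i. if i < r then v i else v' (i - r)"])
qed

text \<open>Multiplying out the two sums gives \<open>r * s\<close> separable terms. This is what
  keeps the rank under control when a polynomial is applied entrywise.\<close>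

lemma has_rank_mult:
  assumes "has_rank N r F" "has_rank N s G"
  shows "has_rank N (r * s) (\<lambda>x y. F x y * G x y)"
proof -
  obtain u v u' v' where
    FG: "\<And>x y. x < N \<Longrightarrow> y < N \<Longrightarrow> F x y = (\<Sum>i<r. u i x * v i y)"
    "\<And>x y. x < N \<Longrightarrow> y < N \<Longrightarrow> G x y = (\<Sum>i<s. u' i x * v' i y)"
    using assms unfolding has_rank_def by blast
  have "F x y * G x y = (\<Sum>k<r * s.
      (u (k div s) x * u' (k mod s) x) * (v (k div s) y * v' (k mod s) y))" if "x < N" "y < N" for x y
    unfolding sum_lessThan_mult[of "\<lambda>i j. (u i x * u' j x) * (v i y * v' j y)" s r]
      FG(1)[OF that] FG(2)[OF that] sum_product by (simp add: mult_ac)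
  then show ?thesis unfolding has_rank_def
    by (intro exI[of _ "\<lambda>k x. u (k div s) x * u' (k mod s) x"]
        exI[of _ "\<lambda>k y. v (k div s) y * v' (k mod s) y"]) simp
qed

lemma has_rank_const: "has_rank N 1 (\<lambda>x y. c)"
  unfolding has_rank_def by (intro exI[of _ "\<lambda>_ _. c"] exI[of _ "\<lambda>_ _. 1"]) simp

lemma has_rank_cmult: "has_rank N r F \<Longrightarrow> has_rank N r (\<lambda>x y. c * F x y)"
  using has_rank_mult[OF has_rank_const[of N c]] by fastforce

lemma has_rank_power: "has_rank N r F \<Longrightarrow> has_rank N (r ^ k) (\<lambda>x y. F x y ^ k)"
  by (induction k) (use has_rank_const[of N 1] in \<open>auto intro: has_rank_mult\<close>)

lemma has_rank_sum:
  "(\<And>j. j < k \<Longrightarrow> has_rank N r (F j)) \<Longrightarrow> has_rank N (k * r) (\<lambda>x y. \<Sum>j<k. F j x y)"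
proof (induction k)
  case 0
  show ?case by (simp add: has_rank_def)
next
  case (Suc k)
  have "has_rank N (k * r + r) (\<lambda>x y. (\<Sum>j<k. F j x y) + F k x y)"
    by (intro has_rank_add Suc) auto
  then show ?case by (simp add: add.commute)
qed

text \<open>The passage from complex to real rank: the real part of a product is the difference of
  two real products, so each term becomes two.\<close>

lemma has_rank_Re:
  assumes "has_rank N r F"
  shows "has_rank N (2 * r) (\<lambda>x y. Re (F x y))"
proof -
  obtain u v where uv: "\<And>x y. x < N \<Longrightarrow> y < N \<Longrightarrow> F x y = (\<Sum>i<r. u i x * v i y)"
    using assms unfolding has_rank_def by blast
  have 1: "has_rank N r (\<lambda>x y. \<Sum>i<r. Re (u i x) * Re (v i y))"
    unfolding has_rank_def
    by (intro exI[of _ "\<lambda>i x. Re (u i x)"] exI[of _ "\<lambda>i x. Re (v i x)"]) simp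
  have 2: "has_rank N r (\<lambda>x y. \<Sum>i<r. Im (u i x) * - Im (v i y))"
    unfolding has_rank_def
    by (intro exI[of _ "\<lambda>i x. Im (u i x)"] exI[of _ "\<lambda>i x. - Im (v i x)"]) simp
  from has_rank_add[OF 1 2] show ?thesis
    unfolding mult_2 by (simp add: has_rank_def uv sum_subtractf sum_negf)
qed

section \<open>Gram matrices and the Eckart-Young bound\<close>

lemma gram_quadratic_form:
  fixes M w :: "nat \<Rightarrow> nat \<Rightarrow> real"
  assumes gram: "\<And>y z. y < N \<Longrightarrow> z < N \<Longrightarrow> (\<Sum>x<N. M x y * M x z) = (\<Sum>i<N. l i * w i y * w i z)"
  shows "(\<Sum>x<N. (dot N (M x) p)\<^sup>2) = (\<Sum>i<N. l i * (dot N (w i) p)\<^sup>2)"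
proof -
  have sq: "(dot N h p)\<^sup>2 = (\<Sum>y<N. \<Sum>z<N. h y * h z * (p y * p z))" for h
    unfolding power2_eq_square dot_def sum_product by (simp add: mult_ac)
  have "(\<Sum>x<N. (dot N (M x) p)\<^sup>2) = (\<Sum>y<N. \<Sum>x<N. \<Sum>z<N. M x y * M x z * (p y * p z))"
    unfolding sq by (rule sum.swap)
  also have "\<dots> = (\<Sum>y<N. \<Sum>z<N. \<Sum>x<N. M x y * M x z * (p y * p z))"
    by (intro sum.cong refl sum.swap)
  also have "\<dots> = (\<Sum>y<N. \<Sum>z<N. (\<Sum>i<N. l i * w i y * w i z) * (p y * p z))"
    by (intro sum.cong refl) (simp add: sum_distrib_right[symmetric] gram)
  also have "\<dots> = (\<Sum>y<N. \<Sum>z<N. \<Sum>i<N. l i * (w i y * w i z * (p y * p z)))"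
    by (simp add: sum_distrib_right mult.assoc)
  also have "\<dots> = (\<Sum>y<N. \<Sum>i<N. \<Sum>z<N. l i * (w i y * w i z * (p y * p z)))"
    by (intro sum.cong refl sum.swap)
  also have "\<dots> = (\<Sum>i<N. \<Sum>y<N. \<Sum>z<N. l i * (w i y * w i z * (p y * p z)))"
    by (rule sum.swap)
  also have "\<dots> = (\<Sum>i<N. l i * (dot N (w i) p)\<^sup>2)"
    unfolding sq by (simp add: sum_distrib_left)
  finally show ?thesis .
qed

lemma gram_trace:
  fixes M w :: "nat \<Rightarrow> nat \<Rightarrow> real"
  assumes gram: "\<And>y z. y < N \<Longrightarrow> z < N \<Longrightarrow> (\<Sum>x<N. M x y * M x z) = (\<Sum>i<N. l i * w i y * w i z)"
    and w: "orthonormal N N w"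
  shows "(\<Sum>x<N. dot N (M x) (M x)) = (\<Sum>i<N. l i)"
proof -
  have "(\<Sum>x<N. dot N (M x) (M x)) = (\<Sum>y<N. \<Sum>x<N. M x y * M x y)"
    unfolding dot_def by (rule sum.swap)
  also have "\<dots> = (\<Sum>y<N. \<Sum>i<N. l i * (w i y * w i y))" by (simp add: gram mult.assoc)
  also have "\<dots> = (\<Sum>i<N. \<Sum>y<N. l i * (w i y * w i y))" by (rule sum.swap)
  also have "\<dots> = (\<Sum>i<N. l i * dot N (w i) (w i))" by (simp add: dot_def sum_distrib_left)
  also have "\<dots> = (\<Sum>i<N. l i)" using w by (simp add: orthonormal_def)
  finally show ?thesis .
qed

text \<open>The quadratic form at \<open>w k\<close> shows that \<open>l k\<close> is the squared
  norm of the image of \<open>w k\<close> under \<open>M\<close>.\<close>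

lemma gram_eigenvalue_nonneg:
  fixes M w :: "nat \<Rightarrow> nat \<Rightarrow> real"
  assumes gram: "\<And>y z. y < N \<Longrightarrow> z < N \<Longrightarrow> (\<Sum>x<N. M x y * M x z) = (\<Sum>i<N. l i * w i y * w i z)"
    and w: "orthonormal N N w" and k: "k < N"
  shows "0 \<le> l k"
proof -
  have "(\<Sum>i<N. l i * (dot N (w i) (w k))\<^sup>2) = (\<Sum>i<N. if i = k then l i else 0)"
    using w k by (intro sum.cong) (auto simp: orthonormal_def)
  then have "l k = (\<Sum>x<N. (dot N (M x) (w k))\<^sup>2)"
    using k gram_quadratic_form[OF gram, where p = "w k"] by simp
  then show ?thesis by (simp add: sum_nonneg)
qed

text \<open>The rows of \<open>F\<close> lie in the span of at most \<open>r\<close> orthonormal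
  functions \<open>q\<close>, so \<open>F\<close> is no closer to \<open>M\<close> than the row-wise
  projection of \<open>M\<close> to that span. The projection captures the sum of all
  \<open>l i * c' i\<close>, where the weights lie in [0,1] and have total at most \<open>r\<close>.
  Hence it captures no more than the \<open>r\<close> largest eigenvalues.\<close>

lemma eckart_young_tail:
  fixes M F :: "nat \<Rightarrow> nat \<Rightarrow> real" and w :: "nat \<Rightarrow> nat \<Rightarrow> real"
  assumes gram: "\<And>y z. y < N \<Longrightarrow> z < N \<Longrightarrow> (\<Sum>x<N. M x y * M x z) = (\<Sum>i<N. l i * w i y * w i z)"
    and w: "orthonormal N N w"
    and w': "\<And>y z. y < N \<Longrightarrow> z < N \<Longrightarrow> (\<Sum>i<N. w i y * w i z) = (if y = z then 1 else 0)"
    and mono: "\<And>i j. i \<le> j \<Longrightarrow> j < N \<Longrightarrow> l j \<le> l i"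
    and F: "has_rank N r F"
  shows "(\<Sum>i<N. l i) - (\<Sum>i<min r N. l i) \<le> (\<Sum>x<N. \<Sum>y<N. (M x y - F x y)\<^sup>2)"
proof -
  obtain u v where F: "\<And>x y. x < N \<Longrightarrow> y < N \<Longrightarrow> F x y = (\<Sum>i<r. u i x * v i y)"
    using F unfolding has_rank_def by blast
  obtain s q c where s: "s \<le> r" and q: "orthonormal N s q"
    and vq: "\<And>i y. i < r \<Longrightarrow> y < N \<Longrightarrow> v i y = (\<Sum>j<s. c i j * q j y)"
    using gram_schmidt_functions[of r N v] by blast
  define d where "d x j = (\<Sum>i<r. u i x * c i j)" for x j
  have Fd: "F x y = (\<Sum>j<s. d x j * q j y)" if "x < N" "y < N" for x y
  proof -
    have "F x y = (\<Sum>i<r. \<Sum>j<s. u i x * c i j * q j y)"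
      using F[OF that] vq that by (simp add: sum_distrib_left mult.assoc)
    also have "\<dots> = (\<Sum>j<s. \<Sum>i<r. u i x * c i j * q j y)" by (rule sum.swap)
    finally show ?thesis by (simp add: d_def sum_distrib_right)
  qed
  note quad = gram_quadratic_form[OF gram] and frob = gram_trace[OF gram w]
    and l = gram_eigenvalue_nonneg[OF gram w]
  have parseval: "(\<Sum>i<N. (dot N (w i) p)\<^sup>2) = dot N p p" for p
  proof -
    have "(\<Sum>i<N. (dot N (w i) p)\<^sup>2) = (\<Sum>i<N. \<Sum>y<N. \<Sum>z<N. w i y * w i z * (p y * p z))"
      unfolding power2_eq_square dot_def sum_product by (simp add: mult_ac)
    also have "\<dots> = (\<Sum>y<N. \<Sum>i<N. \<Sum>z<N. w i y * w i z * (p y * p z))" by (rule sum.swap)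
    also have "\<dots> = (\<Sum>y<N. \<Sum>z<N. \<Sum>i<N. w i y * w i z * (p y * p z))"
      by (intro sum.cong refl sum.swap)
    also have "\<dots> = (\<Sum>y<N. \<Sum>z<N. if z = y then p y * p z else 0)"
      by (intro sum.cong refl) (auto simp: sum_distrib_right[symmetric] w')
    finally show ?thesis by (simp add: dot_def)
  qed
  \<comment> \<open>\<open>c' i\<close> is the squared length of the projection of
    \<open>w i\<close> to the span of \<open>q\<close>. Bessel bounds it by 1, and Parseval for
    \<open>w\<close> makes the total equal to \<open>s\<close>.\<close>
  define c' where "c' i = (\<Sum>j<s. (dot N (w i) (q j))\<^sup>2)" for i
  have c'1: "0 \<le> c' i \<and> c' i \<le> 1" if "i < N" for i
    using bessel_inequality[OF q, of "w i"] w that by (auto simp: c'_def orthonormal_def sum_nonneg)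
  have "(\<Sum>i<N. c' i) = (\<Sum>j<s. \<Sum>i<N. (dot N (w i) (q j))\<^sup>2)"
    unfolding c'_def by (rule sum.swap)
  also have "\<dots> = real s" unfolding parseval using q by (simp add: orthonormal_def)
  finally have c'2: "(\<Sum>i<N. c' i) \<le> real r" using s by simp
  have "(\<Sum>i<N. l i) - (\<Sum>i<min r N. l i) \<le> (\<Sum>i<N. l i) - (\<Sum>i<N. l i * c' i)"
    using weighted_sum_le_head[of N l c' r, OF mono l c'1 c'2] by simp
  also have "(\<Sum>i<N. l i * c' i) = (\<Sum>j<s. \<Sum>i<N. l i * (dot N (w i) (q j))\<^sup>2)"
    unfolding c'_def sum_distrib_left by (rule sum.swap)
  also have "\<dots> = (\<Sum>j<s. \<Sum>x<N. (dot N (M x) (q j))\<^sup>2)" by (simp add: quad)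
  also have "\<dots> = (\<Sum>x<N. \<Sum>j<s. (dot N (M x) (q j))\<^sup>2)" by (rule sum.swap)
  also have "(\<Sum>i<N. l i) - \<dots> = (\<Sum>x<N. dot N (M x) (M x) - (\<Sum>j<s. (dot N (M x) (q j))\<^sup>2))"
    by (simp add: frob[symmetric] sum_subtractf)
  also have "\<dots> \<le> (\<Sum>x<N. dot N (\<lambda>y. M x y - (\<Sum>j<s. d x j * q j y)) (\<lambda>y. M x y - (\<Sum>j<s. d x j * q j y)))"
    by (intro sum_mono orthonormal_residual[OF q])
  also have "\<dots> = (\<Sum>x<N. \<Sum>y<N. (M x y - F x y)\<^sup>2)"
    unfolding dot_def by (intro sum.cong refl) (simp add: Fd power2_eq_square)
  finally show ?thesis .
qed

section \<open>The spectrum of the Gram matrix of \<open>Mf\<close>\<close>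

lemma Mf_carrier: "Mf n f \<in> carrier_mat (2^n) (2^n)"
  by (simp add: Mf_def)

text \<open>The characteristic polynomial of the symmetric Gram matrix splits over the reals, so no
  root is lost in \<open>proots\<close> and every index below \<open>2 ^ n\<close> of
  \<open>sv2_list\<close> names an actual eigenvalue.\<close>

lemma sv2_list_char_poly:
  "char_poly (transpose_mat (Mf n f) * Mf n f) = (\<Prod>e\<leftarrow>sv2_list n f. [:- e, 1:])"
  and mset_sv2_list: "mset (sv2_list n f) = sv2 n f"
  and length_sv2_list: "length (sv2_list n f) = 2 ^ n"
proof -
  let ?A = "transpose_mat (Mf n f) * Mf n f"
  have A: "?A \<in> carrier_mat (2^n) (2^n)" using Mf_carrier[of n f] by simp
  have sym: "transpose_mat ?A = ?A"
    using Mf_carrier[of n f] by (simp add: transpose_mult[of _ "2^n" "2^n" _ "2^n"])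
  obtain es where es: "char_poly ?A = (\<Prod>e\<leftarrow>es. [:- e, 1:])"
    using real_symmetric_char_poly_splits[OF A sym] by blast
  have nz: "(\<Prod>e\<leftarrow>es. [:- e, 1:]) \<noteq> 0" for es :: "real list"
    by (auto simp: prod_list_zero_iff)
  have "proots (\<Prod>e\<leftarrow>es. [:- e, 1:]) = mset es" for es :: "real list"
  proof (induction es)
    case (Cons a es)
    have "proots ([:- a, 1:] * (\<Prod>e\<leftarrow>es. [:- e, 1:])) = proots [:- a, 1:] + mset es"
      using proots_mult[of "[:- a, 1:]" "\<Prod>e\<leftarrow>es. [:- e, 1:]"] nz[of es] Cons.IH by auto
    then show ?case by simp
  qed simp
  then have "sv2 n f = mset es" unfolding sv2_def es .
  then show ms: "mset (sv2_list n f) = sv2 n f" by (simp add: sv2_list_def)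
  have "prod_mset (image_mset (\<lambda>e. [:- e, 1:]) (mset es))
      = prod_mset (image_mset (\<lambda>e. [:- e, 1:]) (mset (sv2_list n f)))"
    using ms \<open>sv2 n f = mset es\<close> by simp
  then show cp: "char_poly ?A = (\<Prod>e\<leftarrow>sv2_list n f. [:- e, 1:])"
    unfolding es by (simp flip: prod_mset_prod_list mset_map)
  have "degree (char_poly ?A) = 2 ^ n" using degree_monic_char_poly[OF A] by simp
  then show "length (sv2_list n f) = 2 ^ n"
    unfolding cp using degree_linear_factors[of uminus "sv2_list n f"] by simp
qed

lemma sv2_list_antimono:
  assumes "i \<le> j" "j < 2 ^ n"
  shows "sv2_list n f ! j \<le> sv2_list n f ! i"
proof -
  have "sorted_wrt (\<ge>) (sv2_list n f)"
    unfolding sv2_list_def sorted_wrt_rev by simp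
  then show ?thesis
    using assms length_sv2_list[of n f] by (cases "i = j") (auto simp: sorted_wrt_iff_nth_less)
qed

text \<open>The \<open>w i\<close> are the columns of the diagonalizing matrix, that is, right
  singular vectors in the order of \<open>sv2_list\<close>. Row orthonormality is recorded as well,
  because Parseval is derived from it.\<close>

lemma Mf_singular_decomposition:
  obtains w where "orthonormal (2^n) (2^n) w"
    and "\<And>y z. y < 2^n \<Longrightarrow> z < 2^n \<Longrightarrow> (\<Sum>i<2^n. w i y * w i z) = (if y = z then 1 else 0)"
    and "\<And>y z. y < 2^n \<Longrightarrow> z < 2^n \<Longrightarrow>
      (\<Sum>x<2^n. (f x y / 2^n) * (f x z / 2^n)) = (\<Sum>i<2^n. sv2_list n f ! i * w i y * w i z)"
proof -
  let ?N = "2 ^ n :: nat" and ?M = "Mf n f"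
  let ?A = "transpose_mat ?M * ?M"
  have A: "?A \<in> carrier_mat ?N ?N" using Mf_carrier[of n f] by simp
  have sym: "transpose_mat ?A = ?A"
    using Mf_carrier[of n f] by (simp add: transpose_mult[of _ ?N ?N _ ?N])
  define D where "D = mat ?N ?N (\<lambda>(i, j). if i = j then sv2_list n f ! i else 0)"
  obtain U where U: "U \<in> carrier_mat ?N ?N" and UU: "transpose_mat U * U = 1\<^sub>m ?N"
    and UD: "transpose_mat U * ?A * U = D"
    using real_symmetric_diagonalization[OF A sym sv2_list_char_poly] unfolding D_def by blast
  have UU': "U * transpose_mat U = 1\<^sub>m ?N"
    using mat_mult_left_right_inverse[OF _ U UU] U by simp
  define w where "w i x = U $$ (x, i)" for i x
  have "U * D * transpose_mat U = (U * transpose_mat U) * ?A * (U * transpose_mat U)"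
    unfolding UD[symmetric] using U A by (simp add: assoc_mult_mat[of _ ?N ?N _ ?N _ ?N])
  then have AD: "?A = U * D * transpose_mat U"
    unfolding UU' using A by (metis left_mult_one_mat right_mult_one_mat)
  show thesis
  proof
    show "orthonormal ?N ?N w"
      unfolding orthonormal_def
    proof (intro allI impI)
      fix i j assume "i < ?N" "j < ?N"
      then show "dot ?N (w i) (w j) = (if i = j then 1 else 0)"
        using arg_cong[OF UU, of "\<lambda>M. M $$ (i, j)"] U
        by (simp add: w_def dot_def scalar_prod_def lessThan_atLeast0)
    qed
  next
    fix y z assume "y < ?N" "z < ?N"
    then show "(\<Sum>i<2^n. w i y * w i z) = (if y = z then 1 else 0)"
      using arg_cong[OF UU', of "\<lambda>M. M $$ (y, z)"] U
      by (simp add: w_def scalar_prod_def lessThan_atLeast0)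
  next
    fix y z assume yz: "y < ?N" "z < ?N"
    have UDi: "(U * D) $$ (y, i) = sv2_list n f ! i * w i y" if i: "i < ?N" for i
    proof -
      have "(U * D) $$ (y, i) = (\<Sum>j<?N. U $$ (y, j) * (if j = i then sv2_list n f ! j else 0))"
        using U yz i by (simp add: D_def scalar_prod_def lessThan_atLeast0)
      also have "\<dots> = (\<Sum>j<?N. if j = i then U $$ (y, j) * sv2_list n f ! j else 0)"
        by (intro sum.cong) auto
      finally show ?thesis using i by (simp add: w_def)
    qed
    have "(\<Sum>x<2^n. (f x y / 2^n) * (f x z / 2^n)) = ?A $$ (y, z)"
      using yz by (simp add: Mf_def scalar_prod_def lessThan_atLeast0)
    also have "\<dots> = (\<Sum>i<?N. (U * D) $$ (y, i) * U $$ (z, i))"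
      unfolding AD using yz U by (simp add: D_def scalar_prod_def lessThan_atLeast0)
    also have "\<dots> = (\<Sum>i<2^n. sv2_list n f ! i * w i y * w i z)"
      by (intro sum.cong refl) (simp add: UDi, simp add: w_def)
    finally show "(\<Sum>x<2^n. (f x y / 2^n) * (f x z / 2^n)) = (\<Sum>i<2^n. sv2_list n f ! i * w i y * w i z)" .
  qed
qed

lemma sv2_list_nonneg:
  assumes "i < 2 ^ n"
  shows "0 \<le> sv2_list n f ! i"
proof -
  obtain w where w: "orthonormal (2^n) (2^n) w"
    and "\<And>y z. y < 2^n \<Longrightarrow> z < 2^n \<Longrightarrow> (\<Sum>i<2^n. w i y * w i z) = (if y = z then 1 else 0)"
    and gram: "\<And>y z. y < 2^n \<Longrightarrow> z < 2^n \<Longrightarrow>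
      (\<Sum>x<2^n. (f x y / 2^n) * (f x z / 2^n)) = (\<Sum>i<2^n. sv2_list n f ! i * w i y * w i z)"
    using Mf_singular_decomposition[where n = n and f = f] by blast
  show ?thesis by (rule gram_eigenvalue_nonneg[OF gram w assms])
qed

lemma sum_sv2_list:
  assumes "boolean_fun n f"
  shows "(\<Sum>i<2^n. sv2_list n f ! i) = 1"
proof -
  obtain w where w: "orthonormal (2^n) (2^n) w"
    and "\<And>y z. y < 2^n \<Longrightarrow> z < 2^n \<Longrightarrow> (\<Sum>i<2^n. w i y * w i z) = (if y = z then 1 else 0)"
    and gram: "\<And>y z. y < 2^n \<Longrightarrow> z < 2^n \<Longrightarrow>
      (\<Sum>x<2^n. (f x y / 2^n) * (f x z / 2^n)) = (\<Sum>i<2^n. sv2_list n f ! i * w i y * w i z)"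
    using Mf_singular_decomposition[where n = n and f = f] by blast
  have sq: "f x y * f x y = 1" if "x < 2^n" "y < 2^n" for x y
  proof -
    have "f x y = 1 \<or> f x y = - 1" using assms that by (simp add: boolean_fun_def)
    then show ?thesis by auto
  qed
  have "(\<Sum>i<2^n. sv2_list n f ! i) = (\<Sum>x<2^n. \<Sum>y<2^n. (f x y / 2^n) * (f x y / 2^n))"
    using gram_trace[OF gram w] by (simp add: dot_def)
  also have "\<dots> = (\<Sum>x<(2::nat)^n. \<Sum>y<(2::nat)^n. 1 / (2^n * 2^n))"
    by (intro sum.cong refl) (simp add: sq)
  finally show ?thesis by simp
qed

text \<open>The factor \<open>1 / 2^n\<close> in \<open>Mf\<close> turns an entrywise error into a
  Frobenius error: each of the \<open>2^n * 2^n\<close> entries contributes at most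
  \<open>e\<^sup>2 / (2^n * 2^n)\<close>.\<close>

lemma sv2_list_tail:
  assumes F: "has_rank (2^n) r F"
    and close: "\<And>x y. x < 2^n \<Longrightarrow> y < 2^n \<Longrightarrow> \<bar>f x y - F x y\<bar> \<le> e"
  shows "(\<Sum>i<2^n. sv2_list n f ! i) - (\<Sum>i<min r (2^n). sv2_list n f ! i) \<le> e\<^sup>2"
proof -
  obtain w where w: "orthonormal (2^n) (2^n) w"
    and w': "\<And>y z. y < 2^n \<Longrightarrow> z < 2^n \<Longrightarrow> (\<Sum>i<2^n. w i y * w i z) = (if y = z then 1 else 0)"
    and gram: "\<And>y z. y < 2^n \<Longrightarrow> z < 2^n \<Longrightarrow>
      (\<Sum>x<2^n. (f x y / 2^n) * (f x z / 2^n)) = (\<Sum>i<2^n. sv2_list n f ! i * w i y * w i z)"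
    using Mf_singular_decomposition[where n = n and f = f] by blast
  have "(\<Sum>i<2^n. sv2_list n f ! i) - (\<Sum>i<min r (2^n). sv2_list n f ! i)
      \<le> (\<Sum>x<2^n. \<Sum>y<2^n. (f x y / 2^n - 1 / 2^n * F x y)\<^sup>2)"
    by (rule eckart_young_tail[OF gram w w' sv2_list_antimono has_rank_cmult[OF F]])
  also have "\<dots> \<le> (\<Sum>x<(2::nat)^n. \<Sum>y<(2::nat)^n. e\<^sup>2 / (2^n * 2^n))"
  proof (intro sum_mono)
    fix x y :: nat assume "x \<in> {..<2^n}" "y \<in> {..<2^n}"
    then have "(f x y - F x y)\<^sup>2 \<le> e\<^sup>2" using close[of x y] by (simp add: abs_le_square_iff[symmetric])
    moreover have "(f x y / 2^n - 1 / 2^n * F x y)\<^sup>2 = (f x y - F x y)\<^sup>2 / (2^n * 2^n)"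
      by (simp add: power2_eq_square field_simps)
    ultimately show "(f x y / 2^n - 1 / 2^n * F x y)\<^sup>2 \<le> e\<^sup>2 / (2^n * 2^n)"
      by (simp add: divide_right_mono)
  qed
  also have "\<dots> = e\<^sup>2" by simp
  finally show ?thesis .
qed

section \<open>Entropy and partial sums of the singular values\<close>

lemma entropy_sv_alt:
  "entropy_sv n f = (\<Sum>i<2^n. if sv2_list n f ! i = 0 then 0
     else - (sv2_list n f ! i * log 2 (sv2_list n f ! i)))"
proof -
  let ?g = "\<lambda>l::real. if l = 0 then 0 else l * log 2 l"
  have "\<Sum>\<^sub># (image_mset ?g (sv2 n f)) = sum_list (map ?g (sv2_list n f))"
    unfolding mset_sv2_list[symmetric] by (simp flip: mset_map sum_mset_sum_list)
  also have "\<dots> = (\<Sum>i<2^n. ?g (sv2_list n f ! i))"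
    by (simp add: sum_list_sum_nth length_sv2_list lessThan_atLeast0)
  finally have "entropy_sv n f = - (\<Sum>i<2^n. ?g (sv2_list n f ! i))" by (simp add: entropy_sv_def)
  also have "\<dots> = (\<Sum>i<2^n. - ?g (sv2_list n f ! i))" by (rule sum_negf[symmetric])
  also have "\<dots> = (\<Sum>i<2^n. if sv2_list n f ! i = 0 then 0
     else - (sv2_list n f ! i * log 2 (sv2_list n f ! i)))" by (intro sum.cong) auto
  finally show ?thesis .
qed

text \<open>Gibbs' inequality against the uniform weight \<open>2 powr -p\<close>, i.e. \<open>ln u \<le> u - 1\<close> at
  \<open>u = 1 / (2^p * l i)\<close>.\<close>
lemma partial_entropy_bound:
  fixes l :: "nat \<Rightarrow> real"
  assumes S: "finite S" "card S \<le> 2 ^ p" and l: "\<And>i. i \<in> S \<Longrightarrow> 0 \<le> l i"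
  shows "(\<Sum>i\<in>S. if l i = 0 then 0 else - (l i * log 2 (l i))) \<le> real p * (\<Sum>i\<in>S. l i) + 2"
proof -
  \<comment> \<open>The additive 2 of the bound comes from \<open>1 / ln 2 \<le> 2\<close>: each
    index loses at most \<open>(1 / 2^p) * (1 / ln 2)\<close>, and there are at most
    \<open>2 ^ p\<close> of them.\<close>
  have "ln (1/2) \<le> 1/2 - (1::real)" by (rule ln_le_minus_one) simp
  then have "1/2 \<le> ln (2::real)" by (simp add: ln_div)
  then have ln2: "1 / ln 2 \<le> (2::real)" by (simp add: field_simps)
  have bound: "(if l i = 0 then 0 else - (l i * log 2 (l i))) \<le> real p * l i + (1 / 2^p) * (1 / ln 2)"
    if i: "i \<in> S" for i
  proof (cases "l i = 0")
    case False
    then have pos: "l i > 0" using l[OF i] by simp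
    have "ln (1 / (2^p * l i)) \<le> 1 / (2^p * l i) - 1" using pos by (intro ln_le_minus_one) simp
    then have "l i * ln (1 / (2^p * l i)) \<le> l i * (1 / (2^p * l i) - 1)"
      using pos by (intro mult_left_mono) auto
    also have "\<dots> \<le> 1 / 2^p" using pos by (simp add: field_simps)
    also have "ln (1 / (2^p * l i)) = - (real p * ln 2) - ln (l i)"
      using pos by (simp add: ln_div ln_mult ln_realpow)
    finally have "- (l i * ln (l i)) \<le> real p * l i * ln 2 + 1 / 2^p" by (simp add: algebra_simps)
    then have "- (l i * ln (l i)) / ln 2 \<le> (real p * l i * ln 2 + 1 / 2^p) / ln 2"
      by (intro divide_right_mono) auto
    then show ?thesis using False by (simp add: log_def add_divide_distrib)
  qed simp
  have "real (card S) \<le> real (2 ^ p)" using S(2) by (simp only: of_nat_le_iff)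
  then have card: "real (card S) / 2^p \<le> 1" by simp
  have "(\<Sum>i\<in>S. if l i = 0 then 0 else - (l i * log 2 (l i)))
      \<le> (\<Sum>i\<in>S. real p * l i + (1 / 2^p) * (1 / ln 2))"
    by (intro sum_mono bound)
  also have "\<dots> = real p * (\<Sum>i\<in>S. l i) + (real (card S) / 2^p) * (1 / ln 2)"
    by (simp add: sum.distrib sum_distrib_left)
  also have "(real (card S) / 2^p) * (1 / ln 2) \<le> 1 * 2"
    using card ln2 by (intro mult_mono) auto
  finally show ?thesis by simp
qed

text \<open>Cauchy-Schwarz against the constant 1, obtained from the nonnegative sum of squared
  differences over all pairs.\<close>

lemma sum_sqrt_le:
  assumes "finite I" and l: "\<And>i. i \<in> I \<Longrightarrow> 0 \<le> l i"
  shows "(\<Sum>i\<in>I. sqrt (l i)) \<le> sqrt (real (card I)) * sqrt (\<Sum>i\<in>I. l i)"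
proof -
  have "0 \<le> (\<Sum>i\<in>I. \<Sum>j\<in>I. (sqrt (l i) - sqrt (l j))\<^sup>2)" by (intro sum_nonneg) simp
  also have "\<dots> = (\<Sum>i\<in>I. \<Sum>j\<in>I. l i + l j - 2 * (sqrt (l i) * sqrt (l j)))"
    using l by (intro sum.cong refl) (simp add: power2_diff)
  also have "\<dots> = 2 * (real (card I) * (\<Sum>i\<in>I. l i)) - 2 * ((\<Sum>i\<in>I. sqrt (l i)) * (\<Sum>i\<in>I. sqrt (l i)))"
  proof -
    have "(\<Sum>i\<in>I. \<Sum>j\<in>I. l i + l j - 2 * (sqrt (l i) * sqrt (l j)))
        = (\<Sum>i\<in>I. \<Sum>j\<in>I. l i + l j) - 2 * (\<Sum>i\<in>I. \<Sum>j\<in>I. sqrt (l i) * sqrt (l j))"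
      by (simp add: sum_subtractf sum_distrib_left)
    also have "(\<Sum>i\<in>I. \<Sum>j\<in>I. l i + l j) = 2 * (real (card I) * (\<Sum>i\<in>I. l i))"
      by (simp add: sum.distrib sum_distrib_left)
    finally show ?thesis unfolding sum_product .
  qed
  finally have "(\<Sum>i\<in>I. sqrt (l i))\<^sup>2 \<le> real (card I) * (\<Sum>i\<in>I. l i)"
    by (simp add: power2_eq_square)
  then show ?thesis using real_le_rsqrt by (simp add: real_sqrt_mult[symmetric])
qed

lemma kappa_alt: "kappa n f k = (\<Sum>i<k. sqrt (sv2_list n f ! i))"
  unfolding kappa_def sigma_def
  by (rule sum.reindex_bij_witness[of _ Suc "\<lambda>i. i - 1"]) auto

text \<open>Ensures that \<open>log 2 (kappa n f k)\<close> is a genuine logarithm. The squares sum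
  to 1, so the largest of them is positive.\<close>

lemma kappa_pos:
  assumes f: "boolean_fun n f" and k: "1 \<le> k" "k \<le> 2^n"
  shows "0 < kappa n f k"
proof -
  have "0 < sv2_list n f ! 0"
  proof (rule ccontr)
    assume "\<not> 0 < sv2_list n f ! 0"
    then have "sv2_list n f ! i \<le> 0" if "i < 2^n" for i
      using sv2_list_antimono[of 0 i n f] that by simp
    then have "(\<Sum>i<2^n. sv2_list n f ! i) \<le> 0" by (intro sum_nonpos) simp
    then show False using sum_sv2_list[OF f] by simp
  qed
  moreover have "sqrt (sv2_list n f ! 0) \<le> kappa n f k"
    unfolding kappa_alt using k by (intro member_le_sum) (auto simp: sv2_list_nonneg)
  ultimately show ?thesis by (smt (verit) real_sqrt_gt_zero)
qed

lemma sum_sv2_list_le_1: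
  assumes "boolean_fun n f" "I \<subseteq> {..<2^n}"
  shows "(\<Sum>i\<in>I. sv2_list n f ! i) \<le> 1"
  unfolding sum_sv2_list[OF assms(1), symmetric]
  using assms(2) by (intro sum_mono2) (auto simp: sv2_list_nonneg)

lemma kappa_le_sqrt:
  assumes "boolean_fun n f" "k \<le> 2^n"
  shows "kappa n f k \<le> sqrt (real k)"
proof -
  have "kappa n f k \<le> sqrt (real k) * sqrt (\<Sum>i<k. sv2_list n f ! i)"
    unfolding kappa_alt using sum_sqrt_le[of "{..<k}" "\<lambda>i. sv2_list n f ! i"] assms
    by (simp add: sv2_list_nonneg)
  also have "\<dots> \<le> sqrt (real k) * 1"
    using assms by (intro mult_left_mono) (auto intro!: sum_sv2_list_le_1)
  finally show ?thesis by simp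
qed

text \<open>Cauchy-Schwarz is applied separately to the first \<open>r'\<close> singular values,
  whose squares have sum at most 1, and to the rest, whose squares have sum at most
  \<open>e\<^sup>2\<close> by Eckart-Young.\<close>

lemma kappa_le_rank:
  assumes f: "boolean_fun n f" and k: "k \<le> 2^n" and F: "has_rank (2^n) r F" and e: "0 \<le> e"
    and close: "\<And>x y. x < 2^n \<Longrightarrow> y < 2^n \<Longrightarrow> \<bar>f x y - F x y\<bar> \<le> e"
  shows "kappa n f k \<le> sqrt (real r) + sqrt (real k) * e"
proof -
  let ?l = "\<lambda>i. sv2_list n f ! i"
  \<comment> \<open>The minimum covers \<open>r \<ge> k\<close> too: the head is then the whole sum
    and the tail is empty.\<close>
  define r' where "r' = min r k"
  have split: "(\<Sum>i<k. g i) = (\<Sum>i<r'. g i) + (\<Sum>i=r'..<k. g i)" for g :: "nat \<Rightarrow> real"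
    unfolding r'_def by (metis atLeast0LessThan min.cobounded2 sum.atLeastLessThan_concat zero_le)
  have "(\<Sum>i<r'. sqrt (?l i)) \<le> sqrt (real r') * sqrt (\<Sum>i<r'. ?l i)"
    using sum_sqrt_le[of "{..<r'}" ?l] k by (simp add: r'_def sv2_list_nonneg)
  also have "\<dots> \<le> sqrt (real r) * 1"
    using k f by (intro mult_mono) (auto simp: r'_def intro!: sum_sv2_list_le_1 sum_nonneg sv2_list_nonneg)
  finally have head: "(\<Sum>i<r'. sqrt (?l i)) \<le> sqrt (real r)" by simp
  have "(\<Sum>i=r'..<k. ?l i) \<le> e\<^sup>2"
  proof (cases "r < k")
    case True
    then have eq: "r' = r" "min r (2^n) = r" using k by (auto simp: r'_def)
    have "(\<Sum>i=r'..<k. ?l i) \<le> (\<Sum>i=r..<2^n. ?l i)"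
      using k unfolding eq by (intro sum_mono2) (auto simp: sv2_list_nonneg)
    also have "\<dots> = (\<Sum>i<2^n. ?l i) - (\<Sum>i<min r (2^n). ?l i)"
      using True k unfolding eq lessThan_atLeast0
      by (subst sum.atLeastLessThan_concat[of 0 r "2^n", symmetric]) auto
    also have "\<dots> \<le> e\<^sup>2" by (rule sv2_list_tail[OF F close])
    finally show ?thesis .
  qed (simp add: r'_def min_def)
  then have "sqrt (\<Sum>i=r'..<k. ?l i) \<le> e" using e by (metis real_sqrt_le_mono real_sqrt_unique)
  moreover have "(\<Sum>i=r'..<k. sqrt (?l i)) \<le> sqrt (real (k - r')) * sqrt (\<Sum>i=r'..<k. ?l i)"
    using sum_sqrt_le[of "{r'..<k}" ?l] k by (simp add: sv2_list_nonneg)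
  moreover have "sqrt (real (k - r')) * sqrt (\<Sum>i=r'..<k. ?l i) \<le> sqrt (real k) * sqrt (\<Sum>i=r'..<k. ?l i)"
    using k by (intro mult_right_mono) (auto intro!: sum_nonneg sv2_list_nonneg)
  ultimately have "(\<Sum>i=r'..<k. sqrt (?l i)) \<le> sqrt (real k) * e"
    by (smt (verit) mult_left_mono of_nat_0_le_iff real_sqrt_ge_zero)
  then show ?thesis unfolding kappa_alt split using head by linarith
qed

section \<open>Decomposition of protocol states\<close>

definition basis_on :: "nat set \<Rightarrow> (nat \<Rightarrow> bool) set" where
  "basis_on S = {b. \<forall>i. i \<notin> S \<longrightarrow> \<not> b i}"

lemma basis_eq_basis_on: "basis m = basis_on {..<m}"
  by (auto simp: basis_def basis_on_def)

lemma finite_basis_on: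
  assumes "finite S"
  shows "finite (basis_on S)"
proof -
  have "basis_on S \<subseteq> (\<lambda>T i. i \<in> T) ` Pow S"
  proof
    fix b assume "b \<in> basis_on S"
    then have "b = (\<lambda>i. i \<in> {i. b i})" "{i. b i} \<subseteq> S" by (auto simp: basis_on_def)
    then show "b \<in> (\<lambda>T i. i \<in> T) ` Pow S" by blast
  qed
  then show ?thesis using assms by (meson finite_Pow_iff finite_imageI finite_subset)
qed

lemma finite_basis: "finite (basis m)"
  by (simp add: basis_eq_basis_on finite_basis_on)

text \<open>A joint basis state amounts to the pair of its restrictions to the qubits of the two
  players.\<close>

lemma sum_basis_split:
  fixes F G :: "(nat \<Rightarrow> bool) \<Rightarrow> complex"
  assumes "S \<inter> T = {}" "S \<union> T = {..<m}"
  shows "(\<Sum>b\<in>basis m. F (restr b S) * G (restr b T)) = (\<Sum>a\<in>basis_on S. F a) * (\<Sum>b\<in>basis_on T. G b)"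
proof -
  have "(\<Sum>a\<in>basis_on S. F a) * (\<Sum>b\<in>basis_on T. G b)
      = (\<Sum>(a, b)\<in>basis_on S \<times> basis_on T. F a * G b)"
    by (simp add: sum_product sum.cartesian_product)
  also have "\<dots> = (\<Sum>b\<in>basis m. F (restr b S) * G (restr b T))"
  proof (rule sum.reindex_bij_witness[of _ "\<lambda>b. (restr b S, restr b T)" "\<lambda>(a, b) i. a i \<or> b i"])
    fix p assume "p \<in> basis_on S \<times> basis_on T"
    then obtain a b where p: "p = (a, b)" and a: "\<And>i. i \<notin> S \<Longrightarrow> \<not> a i" and b: "\<And>i. i \<notin> T \<Longrightarrow> \<not> b i"
      by (auto simp: basis_on_def)
    have 1: "restr (\<lambda>i. a i \<or> b i) S = a" "restr (\<lambda>i. a i \<or> b i) T = b"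
      using a b assms(1) by (auto simp: restr_def fun_eq_iff)
    then show "(restr ((\<lambda>(a, b) i. a i \<or> b i) p) S, restr ((\<lambda>(a, b) i. a i \<or> b i) p) T) = p"
      by (simp add: p)
    show "(case p of (a, b) \<Rightarrow> \<lambda>i. a i \<or> b i) \<in> basis m"
      using a b assms(2) by (auto simp: p basis_eq_basis_on basis_on_def)
    show "F (restr ((\<lambda>(a, b) i. a i \<or> b i) p) S) * G (restr ((\<lambda>(a, b) i. a i \<or> b i) p) T) =
       (case p of (a, b) \<Rightarrow> F a * G b)"
      using 1 by (simp add: p)
  next
    fix b assume "b \<in> basis m"
    then show "(case (restr b S, restr b T) of (a, b) \<Rightarrow> \<lambda>i. a i \<or> b i) = b"
      using assms(2) by (fastforce simp: restr_def fun_eq_iff basis_eq_basis_on basis_on_def)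
  qed (auto simp: basis_on_def restr_def)
  finally show ?thesis by simp
qed

text \<open>The Schmidt-type decomposition of Yao and Kremer: \<open>A i x\<close> is a vector of the player
  holding the qubits \<open>S\<close> with input \<open>x\<close>, and \<open>B i y\<close> one of the player holding \<open>T\<close> with
  input \<open>y\<close>.\<close>
definition schmidt :: "nat \<Rightarrow> nat set \<Rightarrow> nat set \<Rightarrow> nat \<Rightarrow> (nat \<Rightarrow> nat \<Rightarrow> qstate) \<Rightarrow> bool" where
  "schmidt m S T r \<Psi> \<longleftrightarrow> (\<exists>A B. \<forall>x y. \<forall>b\<in>basis m.
      \<Psi> x y b = (\<Sum>i<r. A i x (restr b S) * B i y (restr b T)))"

text \<open>By this symmetry, local operations, sending and measurement need to be treated only for
  the holder of the first qubit set.\<close>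

lemma schmidt_swap:
  assumes "schmidt m S T r \<Psi>"
  shows "schmidt m T S r (\<lambda>y x. \<Psi> x y)"
proof -
  obtain A B where "\<forall>x y. \<forall>b\<in>basis m. \<Psi> x y b = (\<Sum>i<r. A i x (restr b S) * B i y (restr b T))"
    using assms unfolding schmidt_def by blast
  then have "\<forall>y x. \<forall>b\<in>basis m. \<Psi> x y b = (\<Sum>i<r. B i y (restr b T) * A i x (restr b S))"
    by (simp add: mult.commute)
  then show ?thesis unfolding schmidt_def by blast
qed

text \<open>The kernel connects only states that agree outside \<open>S\<close>, and these are
  parametrized by their part on \<open>S\<close>. One \<open>L\<close> serves all states
  \<open>F\<close>.\<close>

lemma apply_local_op:
  assumes K: "local_op m S K" and ST: "S \<inter> T = {}" "S \<union> T = {..<m}"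
  obtains L where "\<And>F b. b \<in> basis m \<Longrightarrow>
    apply_op m K F b = (\<Sum>a\<in>basis_on S. L (restr b S) a * F (\<lambda>i. a i \<or> restr b T i))"
proof -
  obtain L where L: "\<And>b b'. b \<in> basis m \<Longrightarrow> b' \<in> basis m \<Longrightarrow>
      K b b' = (if (\<forall>i. i \<notin> S \<longrightarrow> b i = b' i) then L (restr b S) (restr b' S) else 0)"
    using K unfolding local_op_def by blast
  have "apply_op m K F b = (\<Sum>a\<in>basis_on S. L (restr b S) a * F (\<lambda>i. a i \<or> restr b T i))"
    if b: "b \<in> basis m" for F b
  proof -
    have "apply_op m K F b
        = (\<Sum>b'\<in>basis m. if (\<forall>i. i \<notin> S \<longrightarrow> b i = b' i) then L (restr b S) (restr b' S) * F b' else 0)"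
      unfolding apply_op_def by (intro sum.cong refl) (auto simp: L[OF b])
    also have "\<dots> = (\<Sum>b'\<in>{b'\<in>basis m. \<forall>i. i \<notin> S \<longrightarrow> b i = b' i}. L (restr b S) (restr b' S) * F b')"
      by (intro sum.inter_filter[symmetric] finite_basis)
    also have "\<dots> = (\<Sum>a\<in>basis_on S. L (restr b S) a * F (\<lambda>i. a i \<or> restr b T i))"
    proof (rule sum.reindex_bij_witness[of _ "\<lambda>a i. a i \<or> restr b T i" "\<lambda>b'. restr b' S"])
      fix b' assume b': "b' \<in> {b'\<in>basis m. \<forall>i. i \<notin> S \<longrightarrow> b i = b' i}"
      have eq: "(\<lambda>i. restr b' S i \<or> restr b T i) = b'"
      proof
        fix i show "(restr b' S i \<or> restr b T i) = b' i"
          using b' b ST by (cases "i \<in> S"; cases "i \<in> T")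
            (auto simp: restr_def basis_eq_basis_on basis_on_def)
      qed
      then show "(\<lambda>i. restr b' S i \<or> restr b T i) = b'" .
      show "L (restr b S) (restr b' S) * F (\<lambda>i. restr b' S i \<or> restr b T i)
          = L (restr b S) (restr b' S) * F b'" by (simp only: eq)
      show "restr b' S \<in> basis_on S" by (auto simp: restr_def basis_on_def)
    next
      fix a assume a: "a \<in> basis_on S"
      show "restr (\<lambda>i. a i \<or> restr b T i) S = a"
        using a ST by (auto simp: restr_def basis_on_def fun_eq_iff)
      show "(\<lambda>i. a i \<or> restr b T i) \<in> {b'\<in>basis m. \<forall>i. i \<notin> S \<longrightarrow> b i = b' i}"
        using a ST b by (fastforce simp: restr_def basis_eq_basis_on basis_on_def)
    qed
    finally show ?thesis .
  qed
  then show thesis by (rule that)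
qed

text \<open>\<open>L\<close> acts on the factors \<open>A i x\<close> alone, so the number of terms
  does not grow.\<close>

lemma schmidt_local_op:
  assumes sch: "schmidt m S T r \<Psi>" and K: "local_op m S K"
    and ST: "S \<inter> T = {}" "S \<union> T = {..<m}"
  shows "schmidt m S T r (\<lambda>x y. apply_op m K (\<Psi> x y))"
proof -
  obtain A B where AB: "\<And>x y b. b \<in> basis m \<Longrightarrow>
      \<Psi> x y b = (\<Sum>i<r. A i x (restr b S) * B i y (restr b T))"
    using sch unfolding schmidt_def by blast
  obtain L where L: "\<And>F b. b \<in> basis m \<Longrightarrow>
      apply_op m K F b = (\<Sum>a\<in>basis_on S. L (restr b S) a * F (\<lambda>i. a i \<or> restr b T i))"
    using apply_local_op[OF K ST] by blast
  have "apply_op m K (\<Psi> x y) b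
      = (\<Sum>i<r. (\<Sum>a\<in>basis_on S. L (restr b S) a * A i x a) * B i y (restr b T))"
    if b: "b \<in> basis m" for x y b
  proof -
    have "\<Psi> x y (\<lambda>i. a i \<or> restr b T i) = (\<Sum>i<r. A i x a * B i y (restr b T))"
      if a: "a \<in> basis_on S" for a
    proof -
      have "(\<lambda>i. a i \<or> restr b T i) \<in> basis m"
        using a b ST by (fastforce simp: restr_def basis_eq_basis_on basis_on_def)
      moreover have "restr (\<lambda>i. a i \<or> restr b T i) S = a"
        using a ST by (auto simp: restr_def basis_on_def fun_eq_iff)
      moreover have "restr (\<lambda>i. a i \<or> restr b T i) T = restr b T"
        using a ST by (auto simp: restr_def basis_on_def fun_eq_iff)
      ultimately show ?thesis using AB[of "\<lambda>i. a i \<or> restr b T i" x y] by simp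
    qed
    then have "apply_op m K (\<Psi> x y) b
        = (\<Sum>a\<in>basis_on S. \<Sum>i<r. L (restr b S) a * A i x a * B i y (restr b T))"
      by (simp add: L[OF b] sum_distrib_left mult.assoc)
    also have "\<dots> = (\<Sum>i<r. \<Sum>a\<in>basis_on S. L (restr b S) a * A i x a * B i y (restr b T))"
      by (rule sum.swap)
    finally show ?thesis by (simp add: sum_distrib_right)
  qed
  then show ?thesis unfolding schmidt_def
    by (intro exI[of _ "\<lambda>i x s. \<Sum>a\<in>basis_on S. L s a * A i x a"] exI[of _ B]) simp
qed

text \<open>Splitting by the value of the transmitted bit doubles the terms: in each half the
  sender's factor has the bit fixed and the receiver's factor tests for that value.\<close>

lemma schmidt_send:
  assumes sch: "schmidt m S T r \<Psi>" and q: "q \<in> S" and ST: "S \<inter> T = {}"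
  shows "schmidt m (S - {q}) (insert q T) (2 * r) \<Psi>"
proof -
  obtain A B where AB: "\<And>x y b. b \<in> basis m \<Longrightarrow>
      \<Psi> x y b = (\<Sum>i<r. A i x (restr b S) * B i y (restr b T))"
    using sch unfolding schmidt_def by blast
  \<comment> \<open>The first \<open>r\<close> terms stand for the value \<open>True\<close>, the
    other \<open>r\<close> for \<open>False\<close>. Restriction to \<open>S - {q}\<close> clears
    position \<open>q\<close>, so \<open>A'\<close> restores the fixed value. As \<open>q\<close> is
    not in \<open>T\<close>, \<open>B'\<close> clears it before calling \<open>B\<close>.\<close>
  define A' where "A' i x a = (if i < r then A i x (a(q := True)) else A (i - r) x (a(q := False)))"
    for i x a
  define B' where "B' i y c = (if i < r then if c q then B i y (c(q := False)) else 0
      else if c q then 0 else B (i - r) y (c(q := False)))" for i y c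
  have "\<Psi> x y b = (\<Sum>i<2*r. A' i x (restr b (S - {q})) * B' i y (restr b (insert q T)))"
    if b: "b \<in> basis m" for x y b
  proof -
    have S: "(restr b (S - {q}))(q := b q) = restr b S"
      using q by (auto simp: restr_def fun_eq_iff)
    have T: "(restr b (insert q T))(q := False) = restr b T"
      using q ST by (auto simp: restr_def fun_eq_iff)
    have bq: "restr b (insert q T) q = b q" by (simp add: restr_def)
    have "(\<Sum>i<2*r. A' i x (restr b (S - {q})) * B' i y (restr b (insert q T)))
        = (\<Sum>i<r. A' i x (restr b (S - {q})) * B' i y (restr b (insert q T)))
        + (\<Sum>i<r. A' (r + i) x (restr b (S - {q})) * B' (r + i) y (restr b (insert q T)))"
      unfolding mult_2 by (rule sum_lessThan_add)
    also have "\<dots> = (\<Sum>i<r. A i x (restr b S) * B i y (restr b T))"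
      using S by (cases "b q") (simp_all add: A'_def B'_def T bq)
    finally show ?thesis using AB[OF b] by simp
  qed
  then show ?thesis unfolding schmidt_def by blast
qed

lemma schmidt_round:
  assumes sch: "schmidt m {i. i < m \<and> own i} {i. i < m \<and> \<not> own i} r \<Psi>"
    and K: "local_op m {i. i < m \<and> own i = p} K" and q: "q < m" "own q = p"
  shows "schmidt m {i. i < m \<and> (own(q := \<not> p)) i} {i. i < m \<and> \<not> (own(q := \<not> p)) i} (2 * r)
    (\<lambda>x y. apply_op m K (\<Psi> x y))"
proof -
  let ?S = "{i. i < m \<and> own i}" and ?T = "{i. i < m \<and> \<not> own i}"
  have ST: "?S \<inter> ?T = {}" "?S \<union> ?T = {..<m}" "?T \<inter> ?S = {}" "?T \<union> ?S = {..<m}" by auto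
  show ?thesis
  proof (cases p)
    case True
    then have "schmidt m (?S - {q}) (insert q ?T) (2 * r) (\<lambda>x y. apply_op m K (\<Psi> x y))"
      using K q ST by (intro schmidt_send schmidt_local_op[OF sch]) auto
    moreover have "?S - {q} = {i. i < m \<and> (own(q := \<not> p)) i}"
      "insert q ?T = {i. i < m \<and> \<not> (own(q := \<not> p)) i}" using True q by auto
    ultimately show ?thesis by simp
  next
    case False
    then have "schmidt m (?T - {q}) (insert q ?S) (2 * r) (\<lambda>y x. apply_op m K (\<Psi> x y))"
      using K q ST by (intro schmidt_send schmidt_local_op[OF schmidt_swap[OF sch]]) auto
    moreover have "?T - {q} = {i. i < m \<and> \<not> (own(q := \<not> p)) i}"
      "insert q ?S = {i. i < m \<and> (own(q := \<not> p)) i}" using False q by auto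
    ultimately have "schmidt m {i. i < m \<and> \<not> (own(q := \<not> p)) i} {i. i < m \<and> (own(q := \<not> p)) i}
        (2 * r) (\<lambda>y x. apply_op m K (\<Psi> x y))" by (simp only:)
    from schmidt_swap[OF this] show ?thesis .
  qed
qed

lemma schmidt_evolve:
  assumes "schmidt m {i. i < m \<and> own i} {i. i < m \<and> \<not> own i} r \<Psi>" "valid_rounds m own rs"
  shows "schmidt m {i. i < m \<and> final_owner own rs i} {i. i < m \<and> \<not> final_owner own rs i}
    (2 ^ length rs * r) (\<lambda>x y. evolve m rs (\<Psi> x y))"
  using assms
proof (induction rs arbitrary: own r \<Psi>)
  case (Cons a rs)
  obtain p K q where a: "a = (p, K, q)" by (cases a)
  define own' where "own' = own(q := \<not> p)"
  have "schmidt m {i. i < m \<and> own' i} {i. i < m \<and> \<not> own' i} (2 * r)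
    (\<lambda>x y. apply_op m K (\<Psi> x y))"
    unfolding own'_def using Cons.prems a by (intro schmidt_round) auto
  from Cons.IH[OF this] show ?case using Cons.prems a by (simp add: mult_ac flip: own'_def)
qed simp

text \<open>The initial state is a product of two indicators. The bits of \<open>x\<close> lie on
  one side and those of \<open>y\<close> on the other, so on each side the opposite input may be
  replaced by 0.\<close>

lemma schmidt_init:
  assumes "2 * n \<le> m" "\<forall>i<n. own i" "\<forall>i. n \<le> i \<and> i < 2 * n \<longrightarrow> \<not> own i"
  shows "schmidt m {i. i < m \<and> own i} {i. i < m \<and> \<not> own i} 1 (init_state n)"
proof -
  let ?S = "{i. i < m \<and> own i}" and ?T = "{i. i < m \<and> \<not> own i}"
  have "init_state n x y b = (if restr b ?S = restr (init_basis n x 0) ?S then 1 else 0)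
      * (if restr b ?T = restr (init_basis n 0 y) ?T then 1 else 0)" if b: "b \<in> basis m" for x y b
  proof -
    have "(b = init_basis n x y) \<longleftrightarrow> restr b ?S = restr (init_basis n x 0) ?S
        \<and> restr b ?T = restr (init_basis n 0 y) ?T" (is "_ = ?R")
    proof
      assume "b = init_basis n x y"
      then show ?R using assms by (auto simp: restr_def init_basis_def fun_eq_iff)
    next
      assume R: ?R
      show "b = init_basis n x y"
      proof
        fix i
        consider "i \<in> ?S" | "i \<in> ?T" | "i \<ge> m" by fastforce
        then show "b i = init_basis n x y i"
        proof cases
          case 1
          then have "b i = init_basis n x 0 i"
            using R by (auto simp: restr_def fun_eq_iff split: if_splits)
          then show ?thesis using 1 assms by (auto simp: init_basis_def)
        next
          case 2
          then have "b i = init_basis n 0 y i"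
            using R by (auto simp: restr_def fun_eq_iff split: if_splits)
          then show ?thesis using 2 assms by (auto simp: init_basis_def)
        next
          case 3
          then show ?thesis using b assms by (auto simp: basis_def init_basis_def)
        qed
      qed
    qed
    then show ?thesis by (simp add: init_state_def)
  qed
  then show ?thesis unfolding schmidt_def
    by (intro exI[of _ "\<lambda>i x s. if s = restr (init_basis n x 0) ?S then 1 else 0"]
        exI[of _ "\<lambda>i y t. if t = restr (init_basis n 0 y) ?T then 1 else 0"]) simp
qed

lemma schmidt_final_state:
  assumes "valid_protocol n P"
  defines "own \<equiv> final_owner (own0 P) (rounds P)" and "m \<equiv> nqubits P"
  shows "schmidt m {i. i < m \<and> own i} {i. i < m \<and> \<not> own i} (2 ^ length (rounds P)) (final_state n P)"
proof -
  let ?S = "{i. i < m \<and> own i}" and ?T = "{i. i < m \<and> \<not> own i}"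
  have ST: "?S \<inter> ?T = {}" "?S \<union> ?T = {..<m}" "?T \<inter> ?S = {}" "?T \<union> ?S = {..<m}" by auto
  note v = assms(1)[unfolded valid_protocol_def Let_def, folded own_def m_def]
  have e: "schmidt m ?S ?T (2 ^ length (rounds P)) (\<lambda>x y. evolve m (rounds P) (init_state n x y))"
    using schmidt_evolve[of m "own0 P" 1 "init_state n" "rounds P"] schmidt_init[of n m "own0 P"] v
    by (simp add: own_def)
  have fs: "final_state n P = (\<lambda>x y. apply_op m (fin_op P) (evolve m (rounds P) (init_state n x y)))"
    by (simp add: final_state_def m_def fun_eq_iff)
  show ?thesis
  proof (cases "fin_player P")
    case True
    then show ?thesis unfolding fs using v ST by (intro schmidt_local_op[OF e]) auto
  next
    case False
    then have "schmidt m ?T ?S (2 ^ length (rounds P))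
        (\<lambda>y x. apply_op m (fin_op P) (evolve m (rounds P) (init_state n x y)))"
      using v ST by (intro schmidt_local_op[OF schmidt_swap[OF e]]) auto
    from schmidt_swap[OF this] show ?thesis unfolding fs .
  qed
qed

text \<open>The squared modulus expands into \<open>r * r\<close> cross terms, and the sum over
  basis states of each one factors. The weight \<open>h\<close> sees only the qubit \<open>t\<close>
  in \<open>S\<close>, so it joins the factor depending on \<open>x\<close>.\<close>

lemma schmidt_weighted_norm:
  assumes sch: "schmidt m S T r \<Psi>" and ST: "S \<inter> T = {}" "S \<union> T = {..<m}" and t: "t \<in> S"
  shows "\<exists>G H. \<forall>x y. (\<Sum>b\<in>basis m. h (b t) * complex_of_real ((cmod (\<Psi> x y b))\<^sup>2))
    = (\<Sum>i<r*r. G i x * H i y)"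
proof -
  obtain A B where AB: "\<And>x y b. b \<in> basis m \<Longrightarrow>
      \<Psi> x y b = (\<Sum>i<r. A i x (restr b S) * B i y (restr b T))"
    using sch unfolding schmidt_def by blast
  define G where "G k x = (\<Sum>a\<in>basis_on S. h (a t) * A (k div r) x a * cnj (A (k mod r) x a))" for k x
  define H where "H k y = (\<Sum>b\<in>basis_on T. B (k div r) y b * cnj (B (k mod r) y b))" for k y
  have "(\<Sum>b\<in>basis m. h (b t) * complex_of_real ((cmod (\<Psi> x y b))\<^sup>2)) = (\<Sum>i<r*r. G i x * H i y)"
    for x y
  proof -
    have "(\<Sum>b\<in>basis m. h (b t) * complex_of_real ((cmod (\<Psi> x y b))\<^sup>2))
        = (\<Sum>b\<in>basis m. \<Sum>i<r. \<Sum>j<r.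
            (h (restr b S t) * A i x (restr b S) * cnj (A j x (restr b S)))
            * (B i y (restr b T) * cnj (B j y (restr b T))))"
    proof (rule sum.cong[OF refl])
      fix b assume b: "b \<in> basis m"
      have "restr b S t = b t" using t by (simp add: restr_def)
      moreover have "complex_of_real ((cmod (\<Psi> x y b))\<^sup>2)
          = (\<Sum>i<r. \<Sum>j<r. (A i x (restr b S) * B i y (restr b T))
              * cnj (A j x (restr b S) * B j y (restr b T)))"
        unfolding complex_norm_square AB[OF b] cnj_sum sum_product ..
      ultimately show "h (b t) * complex_of_real ((cmod (\<Psi> x y b))\<^sup>2) = (\<Sum>i<r. \<Sum>j<r.
            (h (restr b S t) * A i x (restr b S) * cnj (A j x (restr b S)))
            * (B i y (restr b T) * cnj (B j y (restr b T))))"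
        by (simp add: sum_distrib_left mult_ac)
    qed
    also have "\<dots> = (\<Sum>i<r. \<Sum>b\<in>basis m. \<Sum>j<r.
            (h (restr b S t) * A i x (restr b S) * cnj (A j x (restr b S)))
            * (B i y (restr b T) * cnj (B j y (restr b T))))"
      by (rule sum.swap)
    also have "\<dots> = (\<Sum>i<r. \<Sum>j<r. \<Sum>b\<in>basis m.
            (h (restr b S t) * A i x (restr b S) * cnj (A j x (restr b S)))
            * (B i y (restr b T) * cnj (B j y (restr b T))))"
      by (rule sum.cong[OF refl], rule sum.swap)
    also have "\<dots> = (\<Sum>i<r. \<Sum>j<r. (\<Sum>a\<in>basis_on S. h (a t) * A i x a * cnj (A j x a))
            * (\<Sum>b\<in>basis_on T. B i y b * cnj (B j y b)))"
      by (rule sum.cong[OF refl], rule sum.cong[OF refl], rule sum_basis_split[OF ST])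
    also have "\<dots> = (\<Sum>k<r*r. G k x * H k y)"
      unfolding G_def H_def
      by (rule sum_lessThan_mult[of "\<lambda>i j. (\<Sum>a\<in>basis_on S. h (a t) * A i x a * cnj (A j x a))
            * (\<Sum>b\<in>basis_on T. B i y b * cnj (B j y b))", symmetric])
    finally show ?thesis .
  qed
  then show ?thesis by blast
qed

section \<open>Norm preservation and output probabilities\<close>

lemma apply_unitary_norm:
  assumes "unitary_op m K"
  shows "(\<Sum>b\<in>basis m. (cmod (apply_op m K \<psi> b))\<^sup>2) = (\<Sum>b\<in>basis m. (cmod (\<psi> b))\<^sup>2)"
proof -
  have "complex_of_real (\<Sum>b\<in>basis m. (cmod (apply_op m K \<psi> b))\<^sup>2)
      = (\<Sum>b\<in>basis m. \<Sum>b2\<in>basis m. \<Sum>b1\<in>basis m. (K b b2 * \<psi> b2) * cnj (K b b1 * \<psi> b1))"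
    unfolding of_real_sum complex_norm_square apply_op_def cnj_sum sum_product ..
  also have "\<dots> = (\<Sum>b2\<in>basis m. \<Sum>b\<in>basis m. \<Sum>b1\<in>basis m. (K b b2 * \<psi> b2) * cnj (K b b1 * \<psi> b1))"
    by (rule sum.swap)
  also have "\<dots> = (\<Sum>b2\<in>basis m. \<Sum>b1\<in>basis m. \<Sum>b\<in>basis m. (K b b2 * \<psi> b2) * cnj (K b b1 * \<psi> b1))"
    by (rule sum.cong[OF refl], rule sum.swap)
  also have "\<dots> = (\<Sum>b2\<in>basis m. \<Sum>b1\<in>basis m. (\<Sum>b\<in>basis m. cnj (K b b1) * K b b2) * (\<psi> b2 * cnj (\<psi> b1)))"
    by (simp add: sum_distrib_right sum_distrib_left mult_ac)
  also have "\<dots> = (\<Sum>b2\<in>basis m. \<Sum>b1\<in>basis m. if b1 = b2 then \<psi> b2 * cnj (\<psi> b1) else 0)"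
    using assms by (intro sum.cong refl) (auto simp: unitary_op_def)
  also have "\<dots> = complex_of_real (\<Sum>b\<in>basis m. (cmod (\<psi> b))\<^sup>2)"
    unfolding of_real_sum complex_norm_square by (simp add: finite_basis)
  finally show ?thesis by (simp only: of_real_eq_iff)
qed

lemma evolve_norm:
  assumes "valid_rounds m own rs"
  shows "(\<Sum>b\<in>basis m. (cmod (evolve m rs \<psi> b))\<^sup>2) = (\<Sum>b\<in>basis m. (cmod (\<psi> b))\<^sup>2)"
  using assms
proof (induction rs arbitrary: own \<psi>)
  case (Cons a rs)
  obtain p K q where a: "a = (p, K, q)" by (cases a)
  have v: "valid_rounds m (own(q := \<not> p)) rs" "unitary_op m K" using Cons.prems a by auto
  show ?case using Cons.IH[OF v(1), of "apply_op m K \<psi>"] apply_unitary_norm[OF v(2), of \<psi>]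
    by (simp add: a)
qed simp

lemma init_basis_in_basis: "2 * n \<le> m \<Longrightarrow> init_basis n x y \<in> basis m"
  by (auto simp: basis_def init_basis_def)

lemma final_state_norm:
  assumes "valid_protocol n P"
  shows "(\<Sum>b\<in>basis (nqubits P). (cmod (final_state n P x y b))\<^sup>2) = 1"
proof -
  have "(\<Sum>b\<in>basis (nqubits P). (cmod (final_state n P x y b))\<^sup>2)
      = (\<Sum>b\<in>basis (nqubits P). (cmod (init_state n x y b))\<^sup>2)"
    using assms unfolding final_state_def valid_protocol_def Let_def
    by (simp add: apply_unitary_norm evolve_norm[of "nqubits P" "own0 P"])
  also have "\<dots> = (\<Sum>b\<in>basis (nqubits P). if b = init_basis n x y then 1 else 0)"
    by (intro sum.cong) (auto simp: init_state_def)
  also have "\<dots> = 1"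
    using assms unfolding valid_protocol_def Let_def
    by (simp add: finite_basis init_basis_in_basis)
  finally show ?thesis .
qed

lemma prob_out_alt:
  "prob_out n P x y c =
    (\<Sum>b\<in>basis (nqubits P). (if b (out_qubit P) = c then 1 else 0) * (cmod (final_state n P x y b))\<^sup>2)"
  unfolding prob_out_def sum.inter_filter[OF finite_basis] by (intro sum.cong) auto

lemma prob_out_add:
  assumes "valid_protocol n P"
  shows "prob_out n P x y True + prob_out n P x y False = 1"
proof -
  have "prob_out n P x y True + prob_out n P x y False
      = (\<Sum>b\<in>basis (nqubits P). (cmod (final_state n P x y b))\<^sup>2)"
    unfolding prob_out_alt sum.distrib[symmetric] by (intro sum.cong) auto
  then show ?thesis using final_state_norm[OF assms] by simp
qed

lemma prob_out_nonneg: "0 \<le> prob_out n P x y c"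
  by (simp add: prob_out_def sum_nonneg)

text \<open>Squaring the \<open>2 ^ c\<close> terms of the state gives \<open>4 ^ c\<close>. An
  arbitrary weight \<open>h\<close> serves both the outcome probabilities and the signed bias. If
  Bob holds the output qubit, the two sides are exchanged.\<close>

lemma protocol_observable_rank:
  assumes "valid_protocol n P"
  shows "has_rank N (4 ^ length (rounds P)) (\<lambda>x y. \<Sum>b\<in>basis (nqubits P).
    h (b (out_qubit P)) * complex_of_real ((cmod (final_state n P x y b))\<^sup>2))"
proof -
  define own where "own = final_owner (own0 P) (rounds P)"
  define m where "m = nqubits P"
  define r :: nat where "r = 2 ^ length (rounds P)"
  let ?S = "{i. i < m \<and> own i}" and ?T = "{i. i < m \<and> \<not> own i}"
  have ST: "?S \<inter> ?T = {}" "?S \<union> ?T = {..<m}" "?T \<inter> ?S = {}" "?T \<union> ?S = {..<m}" by auto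
  have sch: "schmidt m ?S ?T r (final_state n P)"
    using schmidt_final_state[OF assms] unfolding own_def m_def r_def .
  have out: "out_qubit P < m" using assms by (simp add: valid_protocol_def Let_def m_def)
  have rr: "4 ^ length (rounds P) = r * r"
    unfolding r_def power_mult_distrib[symmetric] by simp
  show ?thesis
  proof (cases "own (out_qubit P)")
    case True
    then have "out_qubit P \<in> ?S" using out by simp
    from schmidt_weighted_norm[OF sch ST(1,2) this, of h] show ?thesis
      unfolding has_rank_def rr m_def by blast
  next
    case False
    then have "out_qubit P \<in> ?T" using out by simp
    from schmidt_weighted_norm[OF schmidt_swap[OF sch] ST(3,4) this, of h]
    obtain G H where "\<And>x y. (\<Sum>b\<in>basis m. h (b (out_qubit P)) * complex_of_real ((cmod (final_state n P x y b))\<^sup>2))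
       = (\<Sum>i<r * r. G i y * H i x)" by blast
    then have "\<And>x y. (\<Sum>b\<in>basis m. h (b (out_qubit P)) * complex_of_real ((cmod (final_state n P x y b))\<^sup>2))
       = (\<Sum>i<r * r. H i x * G i y)" by (simp add: mult.commute)
    then show ?thesis unfolding has_rank_def rr m_def by blast
  qed
qed

section \<open>Entrywise amplification\<close>

text \<open>As \<open>j \<ge> m\<close>, the surplus factors \<open>s\<close> can be replaced by the
  larger \<open>l\<close>, leaving \<open>(s * l) ^ m\<close>. For \<open>s\<close> up to 1/3 the
  product \<open>s * (1 - s)\<close> is at most 2/9.\<close>

lemma minority_term_bound:
  fixes s l :: real
  assumes s: "0 \<le> s" "s \<le> 1/3" and l: "l = 1 - s" and j: "m \<le> j" "j \<le> 2 * m"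
  shows "s ^ j * l ^ (2 * m - j) \<le> (2/9) ^ m"
proof -
  have sl: "0 \<le> l" "s \<le> l" using s l by auto
  have "s ^ j * l ^ (2 * m - j) = s ^ m * (s ^ (j - m) * l ^ (2 * m - j))"
    using j by (simp add: power_add[symmetric])
  also have "\<dots> \<le> s ^ m * (l ^ (j - m) * l ^ (2 * m - j))"
    using s sl by (intro mult_left_mono mult_right_mono power_mono) auto
  also have "\<dots> = (s * l) ^ m"
    using j by (simp add: power_add[symmetric] power_mult_distrib)
  also have "\<dots> \<le> (2/9) ^ m"
  proof (rule power_mono)
    have "(1/3 - s) * (2/3 - s) \<ge> 0" using s by (intro mult_nonneg_nonneg) auto
    moreover have "(1/3 - s) * (2/3 - s) = 2/9 - s * l" unfolding l by (simp add: field_simps)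
    ultimately show "s * l \<le> 2/9" by linarith
  qed (use s sl in auto)
  finally show ?thesis .
qed

text \<open>The binomial coefficients of \<open>2 * m\<close> sum to \<open>4 ^ m\<close>, and 4 *
  2/9 = 8/9.\<close>

lemma minority_sum_bound:
  fixes s l :: real
  assumes s: "0 \<le> s" "s \<le> 1/3" and l: "l = 1 - s" and J: "J \<subseteq> {m..2 * m}"
  shows "(\<Sum>j\<in>J. real (2 * m choose j) * (s ^ j * l ^ (2 * m - j))) \<le> (8/9) ^ m"
proof -
  have "(\<Sum>j\<in>J. real (2 * m choose j) * (s ^ j * l ^ (2 * m - j)))
      \<le> (\<Sum>j\<in>J. real (2 * m choose j) * (2/9) ^ m)"
    using J by (intro sum_mono mult_left_mono minority_term_bound[OF s l]) auto
  also have "\<dots> \<le> (\<Sum>j\<le>2 * m. real (2 * m choose j) * (2/9) ^ m)"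
    using J by (intro sum_mono2) auto
  also have "\<dots> = real (\<Sum>j\<le>2 * m. 2 * m choose j) * (2/9) ^ m"
    by (simp add: sum_distrib_right)
  also have "\<dots> = 4 ^ m * (2/9) ^ m"
    by (simp add: choose_row_sum power_mult)
  also have "\<dots> = (8/9) ^ m" by (simp add: power_mult_distrib[symmetric])
  finally show ?thesis .
qed

text \<open>The expected majority vote of \<open>2 * m\<close> independent runs, where
  \<open>p\<close> is the probability of the outcome encoding -1 and a tie counts as -1. Keeping
  \<open>q\<close> in place of \<open>1 - p\<close> makes the polynomial homogeneous, so all its
  monomials obey the same rank bound.\<close>

definition majority :: "nat \<Rightarrow> real \<Rightarrow> real \<Rightarrow> real" where
  "majority m p q = (\<Sum>j<2 * m + 1. (if j < m then 1 else - 1) * real (2 * m choose j) * (p ^ j * q ^ (2 * m - j)))"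

text \<open>The binomial weights have total 1, so the deviation is twice the weight on the wrong
  side.\<close>

lemma majority_approx:
  assumes p: "0 \<le> p" and q: "0 \<le> q" and pq: "p + q = 1"
  shows "2/3 \<le> q \<Longrightarrow> \<bar>1 - majority m p q\<bar> \<le> 2 * (8/9) ^ m"
    and "2/3 \<le> p \<Longrightarrow> \<bar>- 1 - majority m p q\<bar> \<le> 2 * (8/9) ^ m"
proof -
  let ?t = "\<lambda>j. real (2 * m choose j) * (p ^ j * q ^ (2 * m - j))"
  have total: "(\<Sum>j\<le>2 * m. ?t j) = 1"
    using binomial_ring[of p q "2 * m"] pq by (simp add: mult.assoc)
  have set: "{..<2 * m + 1} = {..2 * m}" "{..2 * m} = {..<m} \<union> {m..2 * m}" by auto
  have tot2: "(\<Sum>j<m. ?t j) + (\<Sum>j=m..2 * m. ?t j) = 1"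
    unfolding total[symmetric] set(2) by (subst sum.union_disjoint) auto
  have maj: "majority m p q = (\<Sum>j<m. ?t j) - (\<Sum>j=m..2 * m. ?t j)"
    unfolding majority_def set
    by (subst sum.union_disjoint) (auto simp: sum_negf[symmetric] mult.assoc)
  have nn: "0 \<le> (\<Sum>j<m. ?t j)" "0 \<le> (\<Sum>j=m..2 * m. ?t j)"
    using p q by (auto intro!: sum_nonneg)
  {
    assume "2/3 \<le> q"
    then have "(\<Sum>j=m..2 * m. ?t j) \<le> (8/9) ^ m"
      using minority_sum_bound[of p q "{m..2 * m}" m] p pq by simp
    then show "\<bar>1 - majority m p q\<bar> \<le> 2 * (8/9) ^ m" using tot2 nn unfolding maj by linarith
  }
  {
    assume "2/3 \<le> p"
    \<comment> \<open>Reflecting \<open>j\<close> to \<open>2 * m - j\<close> exchanges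
      \<open>p\<close> and \<open>q\<close>. The range starts at \<open>m + 1\<close> because the
      tie belongs to the other side.\<close>
    have "(\<Sum>j<m. ?t j) = (\<Sum>j=m + 1..2 * m. real (2 * m choose j) * (q ^ j * p ^ (2 * m - j)))"
      by (rule sum.reindex_bij_witness[of _ "\<lambda>j. 2 * m - j" "\<lambda>j. 2 * m - j"])
        (auto simp: binomial_symmetric[symmetric] mult.commute)
    also have "\<dots> \<le> (8/9) ^ m"
      using minority_sum_bound[of q p "{m + 1..2 * m}" m] q pq \<open>2/3 \<le> p\<close> by simp
    finally show "\<bar>- 1 - majority m p q\<bar> \<le> 2 * (8/9) ^ m" using tot2 nn unfolding maj by linarith
  }
qed

lemma majority_rank:
  assumes "has_rank N r P" "has_rank N r Q"
  shows "has_rank N ((2 * m + 1) * r ^ (2 * m)) (\<lambda>x y. majority m (P x y) (Q x y))"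
  unfolding majority_def
proof (rule has_rank_sum)
  fix j assume j: "j < 2 * m + 1"
  have "has_rank N (r ^ j * r ^ (2 * m - j)) (\<lambda>x y. P x y ^ j * Q x y ^ (2 * m - j))"
    by (intro has_rank_mult has_rank_power assms)
  also have "r ^ j * r ^ (2 * m - j) = r ^ (2 * m)"
    using j by (simp add: power_add[symmetric])
  finally show "has_rank N (r ^ (2 * m)) (\<lambda>x y.
      (if j < m then 1 else - 1) * real (2 * m choose j) * (P x y ^ j * Q x y ^ (2 * m - j)))"
    by (rule has_rank_cmult)
qed

lemma prob_out_rank:
  assumes "valid_protocol n P"
  shows "has_rank N (2 * 4 ^ length (rounds P)) (\<lambda>x y. prob_out n P x y c)"
proof -
  have "prob_out n P x y c = Re (\<Sum>b\<in>basis (nqubits P).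
      (if b (out_qubit P) = c then 1 else 0) * complex_of_real ((cmod (final_state n P x y b))\<^sup>2))" for x y
    unfolding prob_out_alt Re_sum by (intro sum.cong) auto
  then show ?thesis
    using has_rank_Re[OF protocol_observable_rank[OF assms, of N "\<lambda>d. if d = c then 1 else 0"]] by simp
qed

lemma computes_cases:
  assumes comp: "computes n f P" and f: "boolean_fun n f" and xy: "x < 2^n" "y < 2^n"
  shows "f x y = 1 \<and> 2/3 \<le> prob_out n P x y False \<or> f x y = - 1 \<and> 2/3 \<le> prob_out n P x y True"
proof -
  have "2/3 \<le> prob_out n P x y (f x y = - 1)" using comp xy by (simp add: computes_def)
  moreover have "f x y = 1 \<or> f x y = - 1" using f xy by (simp add: boolean_fun_def)
  ultimately show ?thesis by auto
qed

lemma protocol_low_rank_approx: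
  assumes comp: "computes n f P" and f: "boolean_fun n f"
  shows "\<exists>F. has_rank (2^n) ((2 * m + 1) * (2 * 4 ^ length (rounds P)) ^ (2 * m)) F \<and>
    (\<forall>x<2^n. \<forall>y<2^n. \<bar>f x y - F x y\<bar> \<le> 2 * (8/9) ^ m)"
proof (intro exI conjI allI impI)
  have v: "valid_protocol n P" using comp by (simp add: computes_def)
  \<comment> \<open>The outcome \<open>True\<close> encodes -1, so its probability is the first
    argument of \<open>majority\<close>.\<close>
  show "has_rank (2^n) ((2 * m + 1) * (2 * 4 ^ length (rounds P)) ^ (2 * m))
     (\<lambda>x y. majority m (prob_out n P x y True) (prob_out n P x y False))"
    by (intro majority_rank prob_out_rank v)
  fix x y :: nat assume xy: "x < 2^n" "y < 2^n"
  from computes_cases[OF comp f xy] show "\<bar>f x y - majority m (prob_out n P x y True) (prob_out n P x y False)\<bar> \<le> 2 * (8/9) ^ m"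
    using majority_approx[OF prob_out_nonneg prob_out_nonneg prob_out_add[OF v], of x y m] by auto
qed

text \<open>The signed bias of the output is a nonvanishing real matrix of complex rank one, so its
  entries are determined by its first row and column, and so are their signs.\<close>
lemma protocol_no_rounds_rank_1:
  assumes comp: "computes n f P" and f: "boolean_fun n f" and "rounds P = []"
  shows "has_rank (2^n) 1 f"
proof -
  have v: "valid_protocol n P" using comp by (simp add: computes_def)
  define D where "D x y = prob_out n P x y False - prob_out n P x y True" for x y
  define Dc where "Dc x y = (\<Sum>b\<in>basis (nqubits P). (if b (out_qubit P) then - 1 else 1)
      * complex_of_real ((cmod (final_state n P x y b))\<^sup>2))" for x y
  have Dc: "Dc x y = complex_of_real (D x y)" for x y
    unfolding D_def Dc_def prob_out_alt sum_subtractf[symmetric] of_real_sum by (intro sum.cong) auto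
  \<comment> \<open>Here the rank bound is \<open>4 ^ 0\<close>, that is 1. The bias is kept complex
    because taking real parts would double the bound.\<close>
  have "has_rank (2^n) 1 Dc"
    using protocol_observable_rank[OF v, of "2^n" "\<lambda>d. if d then - 1 else 1"] assms(3)
    unfolding Dc_def by simp
  then obtain g h where gh: "\<And>x y. x < 2^n \<Longrightarrow> y < 2^n \<Longrightarrow> Dc x y = g x * h y"
    by (auto simp: has_rank_def)
  have fD: "f x y = sgn (D x y) \<and> D x y \<noteq> 0" if "x < 2^n" "y < 2^n" for x y
  proof -
    from computes_cases[OF comp f that] show ?thesis
      using prob_out_add[OF v, of x y] by (auto simp: D_def sgn_if)
  qed
  \<comment> \<open>The 2x2 minors of a rank-one matrix vanish. This identity involves only real
    entries, so it transfers back from the complex matrix.\<close>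
  have D: "D x y * D 0 0 = D x 0 * D 0 y" if "x < 2^n" "y < 2^n" for x y
  proof -
    have "complex_of_real (D x y * D 0 0) = complex_of_real (D x 0 * D 0 y)"
      using that by (simp add: Dc[symmetric] gh)
    then show ?thesis by (simp only: of_real_eq_iff)
  qed
  have rank1: "f x y = f x 0 * (f 0 y * f 0 0)" if "x < 2^n" "y < 2^n" for x y
  proof -
    have "sgn (D x y) * sgn (D 0 0) = sgn (D x 0) * sgn (D 0 y)"
      using D[OF that] by (simp add: sgn_mult[symmetric])
    then show ?thesis
      using that fD[of x y] fD[of 0 0] fD[of x 0] fD[of 0 y] by (auto simp: sgn_if split: if_splits)
  qed
  show ?thesis unfolding has_rank_def
  proof (intro exI allI impI)
    fix x y :: nat assume "x < 2^n" "y < 2^n"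
    from rank1[OF this] show "f x y = (\<Sum>i<(1::nat). (\<lambda>_ x. f x 0) i x * (\<lambda>_ y. f 0 y * f 0 0) i y)"
      by simp
  qed
qed

section \<open>A protocol for every function\<close>

definition perm_op :: "((nat \<Rightarrow> bool) \<Rightarrow> nat \<Rightarrow> bool) \<Rightarrow> qop" where
  "perm_op g b b' = (if b = g b' then 1 else 0)"

text \<open>An involution is injective, so the columns of the kernel are distinct unit
  vectors.\<close>

lemma unitary_perm_op:
  assumes "\<And>b. b \<in> basis m \<Longrightarrow> g b \<in> basis m" "\<And>b. b \<in> basis m \<Longrightarrow> g (g b) = b"
  shows "unitary_op m (perm_op g)"
  unfolding unitary_op_def
proof (intro ballI)
  fix b1 b2 assume b: "b1 \<in> basis m" "b2 \<in> basis m"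
  have "(\<Sum>b\<in>basis m. cnj (perm_op g b b1) * perm_op g b b2)
      = (\<Sum>b\<in>basis m. if b = g b1 then if b1 = b2 then 1 else 0 else 0)"
    by (intro sum.cong refl) (use b assms(2) in \<open>auto simp: perm_op_def, metis\<close>)
  then show "(\<Sum>b\<in>basis m. cnj (perm_op g b b1) * perm_op g b b2) = (if b1 = b2 then 1 else 0)"
    using assms(1) b by (simp add: finite_basis)
qed

lemma apply_perm_op:
  assumes "b0 \<in> basis m"
  shows "apply_op m (perm_op g) (\<lambda>b. if b = b0 then 1 else 0) = (\<lambda>b. if b = g b0 then 1 else 0)"
proof
  fix b
  have "apply_op m (perm_op g) (\<lambda>b. if b = b0 then 1 else 0) b
      = (\<Sum>b'\<in>basis m. if b' = b0 then perm_op g b b0 else 0)"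
    unfolding apply_op_def by (intro sum.cong) auto
  then show "apply_op m (perm_op g) (\<lambda>b. if b = b0 then 1 else 0) b = (if b = g b0 then 1 else 0)"
    using assms by (simp add: finite_basis perm_op_def)
qed

lemma local_perm_op_id: "local_op m S (perm_op (\<lambda>b. b))"
proof -
  have eq: "(b = b') \<longleftrightarrow> (\<forall>i. i \<notin> S \<longrightarrow> b i = b' i) \<and> restr b S = restr b' S" for b b'
  proof
    assume R: "(\<forall>i. i \<notin> S \<longrightarrow> b i = b' i) \<and> restr b S = restr b' S"
    show "b = b'"
    proof
      fix i
      have "restr b S i = restr b' S i" using R by simp
      then show "b i = b' i" using R by (cases "i \<in> S") (simp_all add: restr_def)
    qed
  qed simp
  show ?thesis unfolding local_op_def
  proof (intro exI ballI)
    fix b b'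
    show "perm_op (\<lambda>b. b) b b' = (if \<forall>i. i \<notin> S \<longrightarrow> b i = b' i
        then perm_op (\<lambda>b. b) (restr b S) (restr b' S) else 0)"
      using eq[of b b'] unfolding perm_op_def by (cases "b = b'") auto
  qed
qed

lemma valid_rounds_send_all:
  assumes "distinct qs" "\<forall>q\<in>set qs. q < m \<and> own q"
  shows "valid_rounds m own (map (\<lambda>q. (True, perm_op (\<lambda>b. b), q)) qs)"
  using assms
proof (induction qs arbitrary: own)
  case (Cons a qs)
  have "valid_rounds m (own(a := False)) (map (\<lambda>q. (True, perm_op (\<lambda>b. b), q)) qs)"
    by (rule Cons.IH) (use Cons.prems in auto)
  then show ?case using Cons.prems by (simp add: unitary_perm_op local_perm_op_id)
qed simp

lemma final_owner_send_all:
  "final_owner own (map (\<lambda>q. (True, K, q)) qs) = (\<lambda>i. if i \<in> set qs then False else own i)"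
  by (induction qs arbitrary: own) (auto simp: fun_eq_iff)

lemma evolve_send_all:
  assumes "b0 \<in> basis m"
  shows "evolve m (map (\<lambda>q. (True, perm_op (\<lambda>b. b), q)) qs) (\<lambda>b. if b = b0 then 1 else 0)
    = (\<lambda>b. if b = b0 then 1 else 0)"
  by (induction qs) (auto simp: apply_perm_op[OF assms])

lemma init_basis_inject:
  assumes "x < 2^n" "y < 2^n" "x' < 2^n" "y' < 2^n"
    and eq: "\<forall>i<2 * n. init_basis n x y i = init_basis n x' y' i"
  shows "x = x' \<and> y = y'"
proof
  have "bit x i = bit x' i" if "i < n" for i
    using eq[rule_format, of i] that by (simp add: init_basis_def)
  then have "take_bit n x = take_bit n x'" by (auto simp: bit_eq_iff bit_take_bit_iff)
  then show "x = x'" using assms by (simp add: take_bit_nat_eq_self)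
  have "bit y i = bit y' i" if "i < n" for i
    using eq[rule_format, of "n + i"] that by (simp add: init_basis_def)
  then have "take_bit n y = take_bit n y'" by (auto simp: bit_eq_iff bit_take_bit_iff)
  then show "y = y'" using assms by (simp add: take_bit_nat_eq_self)
qed

text \<open>\<open>BQC\<close> is a \<open>LEAST\<close>, so it is an attained cost only once some
  computing protocol is known. Here Alice sends her \<open>n\<close> input qubits, and Bob, who then
  holds everything, flips the output qubit \<open>2 * n\<close> exactly when the value is
  -1.\<close>

lemma computing_protocol_exists: "\<exists>P. computes n f P"
proof -
  \<comment> \<open>\<open>F\<close> reads the value off the first \<open>2 * n\<close> qubits. The
    map \<open>g\<close> changes only qubit \<open>2 * n\<close>, so it preserves \<open>F\<close>
    and is an involution.\<close>
  define F where "F b \<longleftrightarrow> (\<exists>x<2^n. \<exists>y<2^n. f x y = - 1 \<and> (\<forall>i<2 * n. b i = init_basis n x y i))"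
    for b :: "nat \<Rightarrow> bool"
  define g where "g b = b(2 * n := (b (2 * n) \<noteq> F b))" for b
  define P where "P = \<lparr>nqubits = 2 * n + 1, own0 = (\<lambda>i. i < n),
      rounds = map (\<lambda>q. (True, perm_op (\<lambda>b. b), q)) [0..<n],
      fin_player = False, fin_op = perm_op g, out_qubit = 2 * n\<rparr>"
  have Fg: "F (g b) = F b" for b by (simp add: F_def g_def)
  have gg: "g (g b) = b" for b unfolding g_def[of "g b"] Fg by (rule ext) (auto simp: g_def)
  have gb: "g b \<in> basis (2 * n + 1)" if "b \<in> basis (2 * n + 1)" for b
    using that by (auto simp: g_def basis_def)
  \<comment> \<open>After the transmissions Bob holds every qubit, so locality is required for the
    whole system only.\<close>
  have "local_op (2 * n + 1) {i. i < 2 * n + 1} (perm_op g)"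
    unfolding local_op_def
  proof (intro exI ballI)
    fix b b' assume b: "b \<in> basis (2 * n + 1)" "b' \<in> basis (2 * n + 1)"
    then have "restr b {i. i < 2 * n + 1} = b" "restr b' {i. i < 2 * n + 1} = b'"
      by (auto simp: restr_def basis_def fun_eq_iff)
    moreover have "\<forall>i. i \<notin> {i. i < 2 * n + 1} \<longrightarrow> b i = b' i" using b by (auto simp: basis_def)
    ultimately show "perm_op g b b' = (if \<forall>i. i \<notin> {i. i < 2 * n + 1} \<longrightarrow> b i = b' i
        then perm_op g (restr b {i. i < 2 * n + 1}) (restr b' {i. i < 2 * n + 1}) else 0)" by simp
  qed
  moreover have "{i. \<not> i < n \<longrightarrow> i < Suc (2 * n)} = {i. i < Suc (2 * n)}" by auto
  ultimately have valid: "valid_protocol n P"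
    unfolding valid_protocol_def P_def
    using valid_rounds_send_all[of "[0..<n]" "2 * n + 1" "\<lambda>i. i < n"] unitary_perm_op[of "2 * n + 1" g] gg gb
    by (simp add: final_owner_send_all)
  have "prob_out n P x y (f x y = - 1) = 1" if xy: "x < 2^n" "y < 2^n" for x y
  proof -
    let ?b = "init_basis n x y"
    have b: "?b \<in> basis (2 * n + 1)" by (rule init_basis_in_basis) simp
    have "F ?b \<longleftrightarrow> f x y = - 1" unfolding F_def using init_basis_inject xy by metis
    then have out: "g ?b (2 * n) = (f x y = - 1)" by (simp add: g_def init_basis_def)
    have init: "init_state n x y = (\<lambda>b. if b = ?b then 1 else 0)" by (simp add: init_state_def fun_eq_iff)
    have fin: "final_state n P x y = (\<lambda>b. if b = g ?b then 1 else 0)"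
      unfolding final_state_def P_def init by (simp add: evolve_send_all[OF b, simplified] apply_perm_op[OF b, simplified])
    have "prob_out n P x y (f x y = - 1)
        = (\<Sum>b\<in>basis (2 * n + 1). if b = g ?b then 1 else 0)"
      unfolding prob_out_alt fin using out by (intro sum.cong) (auto simp: P_def)
    then show ?thesis using gb[OF b] by (simp add: finite_basis)
  qed
  then show ?thesis using valid by (intro exI[of _ P]) (simp add: computes_def)
qed

lemma BQC_protocol: obtains P where "computes n f P" "length (rounds P) = BQC n f"
proof -
  have "\<exists>P. computes n f P \<and> length (rounds P) = BQC n f"
    unfolding BQC_def by (rule LeastI_ex) (use computing_protocol_exists[of n f] in blast)
  then show thesis using that by blast
qed

section \<open>Lower bounds\<close>

lemma BQC_zero_rank:
  assumes "boolean_fun n f" "BQC n f = 0"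
  shows "has_rank (2^n) 1 f"
proof -
  obtain P where "computes n f P" "length (rounds P) = BQC n f" by (rule BQC_protocol)
  then show ?thesis using protocol_no_rounds_rank_1 assms by auto
qed

text \<open>The factor \<open>2 * m + 1\<close> costs at most \<open>2 * m\<close> further bits, for
  an exponent of 4cm + 4m. With \<open>c \<ge> 1\<close> this is at most 8cm.\<close>

lemma majority_rank_le:
  assumes "c \<ge> 1"
  shows "(2 * m + 1) * (2 * 4 ^ c) ^ (2 * m) \<le> (2::nat) ^ (8 * c * m)"
proof -
  have "2 * m + 1 \<le> (2::nat) ^ (2 * m)"
    by (induction m) (auto simp: algebra_simps)
  moreover have "(2 * 4 ^ c) ^ (2 * m) = (2::nat) ^ ((2 * c + 1) * (2 * m))"
  proof -
    have "(4::nat) = 2 ^ 2" by simp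
    then have "(2 * 4 ^ c :: nat) = 2 ^ (2 * c + 1)" by (simp only: power_mult[symmetric] power_add) simp
    then show ?thesis by (simp only: power_mult)
  qed
  ultimately have "(2 * m + 1) * (2 * 4 ^ c) ^ (2 * m) \<le> (2::nat) ^ (2 * m) * 2 ^ ((2 * c + 1) * (2 * m))"
    by (intro mult_le_mono) simp_all
  also have "\<dots> = 2 ^ (2 * m + (2 * c + 1) * (2 * m))" by (simp only: power_add)
  also have "\<dots> \<le> 2 ^ (8 * c * m)"
  proof (rule power_increasing)
    have "m \<le> c * m" using assms by simp
    then show "2 * m + (2 * c + 1) * (2 * m) \<le> 8 * c * m" by (simp add: algebra_simps)
  qed simp
  finally show ?thesis .
qed

lemma BQC_low_rank_approx:
  assumes f: "boolean_fun n f" and c: "BQC n f \<ge> 1"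
  obtains r F where "has_rank (2^n) r F" "r \<le> 2 ^ (8 * BQC n f * m)"
    "\<And>x y. x < 2^n \<Longrightarrow> y < 2^n \<Longrightarrow> \<bar>f x y - F x y\<bar> \<le> 2 * (8/9) ^ m"
proof -
  obtain P where P: "computes n f P" "length (rounds P) = BQC n f" by (rule BQC_protocol)
  show thesis
    using protocol_low_rank_approx[OF P(1) f, of m] majority_rank_le[OF c, of m] that
    unfolding P(2) by blast
qed

text \<open>With \<open>f\<close> as its own approximation the error is 0, so Eckart-Young puts all
  the mass on the first squared singular value, and 1 log 1 = 0.\<close>

lemma entropy_rank_1:
  assumes f: "boolean_fun n f" and r: "has_rank (2^n) 1 f"
  shows "entropy_sv n f = 0"
proof -
  let ?l = "\<lambda>i. sv2_list n f ! i"
  have "(\<Sum>i<2^n. ?l i) - (\<Sum>i<min 1 (2^n). ?l i) \<le> 0\<^sup>2"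
    by (rule sv2_list_tail[OF r]) simp
  moreover have "min 1 (2^n) = (1::nat)" by (simp add: min_def)
  ultimately have ge: "?l 0 \<ge> 1" using sum_sv2_list[OF f] by simp
  have "(\<Sum>i<2^n. ?l i) = ?l 0 + (\<Sum>i\<in>{..<2^n} - {0}. ?l i)" by (rule sum.remove) auto
  moreover have "0 \<le> (\<Sum>i\<in>{..<2^n} - {0}. ?l i)" by (intro sum_nonneg) (auto simp: sv2_list_nonneg)
  ultimately have l0: "?l 0 = 1" and z: "(\<Sum>i\<in>{..<2^n} - {0}. ?l i) = 0"
    using sum_sv2_list[OF f] ge by linarith+
  have "?l i = 0" if "i < 2^n" "i \<noteq> 0" for i
    using z that by (subst (asm) sum_nonneg_eq_0_iff) (auto simp: sv2_list_nonneg)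
  then have "(if ?l i = 0 then 0 else - (?l i * log 2 (?l i))) = 0" if "i < 2^n" for i
    using that l0 by (cases "i = 0") auto
  then show ?thesis unfolding entropy_sv_alt by (intro sum.neutral) simp
qed

text \<open>Converts halving after \<open>d\<close> factors into decay in \<open>t\<close>. It is
  applied to 64/81 with \<open>d = 3\<close> and to 8/9 with \<open>d = 6\<close>.\<close>

lemma power_le_inverse_powr:
  fixes q t :: real
  assumes q: "0 < q" "q ^ d \<le> 1/2" and m: "real d * t \<le> real m" and t: "0 \<le> t"
  shows "q ^ m \<le> 2 powr - t"
proof (cases "d = 0")
  case False
  have "ln (q ^ d) \<le> ln (1/2)" using q by (subst ln_le_cancel_iff) auto
  then have lq: "real d * ln q \<le> - ln 2" using q by (simp add: ln_realpow ln_div)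
  moreover have "ln 2 > (0::real)" by simp
  ultimately have "real d * ln q < 0" by linarith
  then have neg: "ln q < 0" using False by (simp add: mult_less_0_iff)
  have "real m * ln q \<le> (real d * t) * ln q" using m neg by (intro mult_right_mono_neg) auto
  also have "\<dots> = t * (real d * ln q)" by simp
  also have "\<dots> \<le> t * - ln 2" using lq t by (intro mult_left_mono) auto
  finally have "ln (q ^ m) \<le> - t * ln 2" using q by (simp add: ln_realpow)
  then have "exp (ln (q ^ m)) \<le> exp (- t * ln 2)" by simp
  then show ?thesis using q by (simp add: powr_def)
\<comment> \<open>For \<open>d = 0\<close> the assumption reads \<open>1 \<le> 1/2\<close>.\<close>
qed (use q in simp)

lemma entropy_le_BQC:
  assumes f: "boolean_fun n f" and n: "n \<ge> 2"
  shows "entropy_sv n f \<le> 40 * real (BQC n f) * log 2 (real n)"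
proof (cases "BQC n f = 0")
  case True
  then show ?thesis using entropy_rank_1[OF f BQC_zero_rank[OF f True]] by simp
next
  case False
  define c where "c = BQC n f"
  have c: "c \<ge> 1" using False by (simp add: c_def)
  define t where "t = log 2 (real n)"
  have "log 2 2 \<le> log 2 (real n)" using n by (subst log_le_cancel_iff) auto
  then have t: "t \<ge> 1" by (simp add: t_def)
  \<comment> \<open>As (64/81)^3 is below 1/2, the factor 3 gives
    \<open>(64/81) ^ m \<le> 1 / n\<close>. Rounding up costs at most 1, hence at most
    \<open>t\<close>.\<close>
  define m where "m = nat \<lceil>3 * t\<rceil>"
  have m: "3 * t \<le> real m" "real m \<le> 4 * t"
    using t unfolding m_def by linarith+
  obtain r F where F: "has_rank (2^n) r F" and r: "r \<le> 2 ^ (8 * c * m)"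
    and close: "\<And>x y. x < 2^n \<Longrightarrow> y < 2^n \<Longrightarrow> \<bar>f x y - F x y\<bar> \<le> 2 * (8/9) ^ m"
    using BQC_low_rank_approx[OF f, of m] c unfolding c_def by metis
  let ?l = "\<lambda>i. sv2_list n f ! i"
  let ?\<eta> = "\<lambda>i. if ?l i = 0 then 0 else - (?l i * log 2 (?l i))"
  define r' where "r' = min r (2^n)"
  have r': "r' \<le> 2^n" "r' \<le> 2 ^ (8 * c * m)" using r by (auto simp: r'_def)
  have split: "(\<Sum>i<2^n. g i) = (\<Sum>i<r'. g i) + (\<Sum>i=r'..<2^n. g i)" for g :: "nat \<Rightarrow> real"
    using r' by (metis atLeast0LessThan sum.atLeastLessThan_concat zero_le)
  have "(64/81::real) ^ m \<le> 2 powr - t"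
    by (rule power_le_inverse_powr[of _ 3]) (use m t in \<open>auto simp: power_divide\<close>)
  also have "\<dots> = 1 / real n" using n by (simp add: t_def powr_minus_divide)
  finally have small: "(64/81::real) ^ m * real n \<le> 1" using n by (simp add: field_simps)
  have tail: "(\<Sum>i=r'..<2^n. ?l i) \<le> 4 * (64/81) ^ m"
  proof -
    have "(\<Sum>i=r'..<2^n. ?l i) \<le> (2 * (8/9) ^ m)\<^sup>2"
      using sv2_list_tail[OF F close] unfolding r'_def[symmetric] split by simp
    also have "\<dots> = 4 * ((8/9)\<^sup>2) ^ m"
      unfolding power_mult_distrib power_mult[symmetric] by (simp add: mult.commute)
    finally show ?thesis by (simp add: power2_eq_square)
  qed
  have "(\<Sum>i<r'. ?\<eta> i) \<le> real (8 * c * m) * (\<Sum>i<r'. ?l i) + 2"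
    using r' by (intro partial_entropy_bound) (auto simp: sv2_list_nonneg)
  also have "\<dots> \<le> real (8 * c * m) * 1 + 2"
    using r' by (intro add_right_mono mult_left_mono sum_sv2_list_le_1[OF f]) auto
  finally have head: "(\<Sum>i<r'. ?\<eta> i) \<le> 8 * real c * real m + 2" by simp
  \<comment> \<open>The tail has at most \<open>2 ^ n\<close> entries and mass at most 4 / n, so its
    entropy is at most 4 + 2.\<close>
  have "(\<Sum>i=r'..<2^n. ?\<eta> i) \<le> real n * (\<Sum>i=r'..<2^n. ?l i) + 2"
    by (intro partial_entropy_bound) (auto simp: sv2_list_nonneg)
  also have "\<dots> \<le> real n * (4 * (64/81) ^ m) + 2"
    using tail by (intro add_right_mono mult_left_mono) auto
  also have "\<dots> \<le> 6" using small by (simp add: mult_ac)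
  finally have "entropy_sv n f \<le> 8 * real c * real m + 8"
    using head unfolding entropy_sv_alt split by linarith
  \<comment> \<open>The additive 8 = 2 + 6 from head and tail is absorbed by
    \<open>real c * t \<ge> 1\<close>, which makes the constant 32 + 8 = 40.\<close>
  also have "\<dots> \<le> 8 * real c * (4 * t) + 8 * (real c * t)"
  proof -
    have "8 * real c * real m \<le> 8 * real c * (4 * t)" using m by (intro mult_left_mono) auto
    moreover have "1 * 1 \<le> real c * t" using c t by (intro mult_mono) auto
    ultimately show ?thesis by linarith
  qed
  finally show ?thesis by (simp add: c_def t_def)
qed

lemma log_kappa_le_BQC:
  assumes f: "boolean_fun n f" and k: "1 \<le> k" "k \<le> 2^n" and \<kappa>: "kappa n f k > 1"
  shows "log 2 (kappa n f k)
    \<le> 53 * real (BQC n f) * (log 2 (sqrt (real k)) - log 2 (kappa n f k) + 1)"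
proof (cases "BQC n f = 0")
  case True
  \<comment> \<open>Rank one with error 0 forces \<open>kappa n f k \<le> 1\<close>, against the
    assumption.\<close>
  have "kappa n f k \<le> sqrt (real 1) + sqrt (real k) * 0"
    by (rule kappa_le_rank[OF f k(2) BQC_zero_rank[OF f True]]) auto
  then show ?thesis using \<kappa> by simp
next
  case False
  define c where "c = BQC n f"
  have c: "c \<ge> 1" using False by (simp add: c_def)
  define \<kappa> where "\<kappa> = kappa n f k"
  have \<kappa>1: "\<kappa> > 1" using \<kappa> by (simp add: \<kappa>_def)
  have sk: "sqrt (real k) > 0" using k by simp
  define L where "L = log 2 (sqrt (real k)) - log 2 \<kappa> + 1"
  have "log 2 \<kappa> \<le> log 2 (sqrt (real k))"
    using kappa_le_sqrt[OF f k(2)] \<kappa>1 sk by (subst log_le_cancel_iff) (auto simp: \<kappa>_def)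
  then have L: "L \<ge> 1" by (simp add: L_def)
  \<comment> \<open>As (8/9)^6 is below 1/2, this \<open>m\<close> makes \<open>(8/9) ^ m\<close> at
    most \<open>2 powr - (L + 1)\<close>, a quarter of \<open>\<kappa> / sqrt (real k)\<close>. The
    error term is then at most \<open>\<kappa> / 2\<close>. With \<open>L \<ge> 1\<close>, rounding
    gives at most 6L + 7, hence 13L.\<close>
  define m where "m = nat \<lceil>6 * (L + 1)\<rceil>"
  have "real m = of_int \<lceil>6 * (L + 1)\<rceil>" using L by (simp add: m_def)
  then have m: "6 * (L + 1) \<le> real m" "real m \<le> 13 * L"
    using L of_int_ceiling_le_add_one[of "6 * (L + 1)"] by auto
  obtain r F where F: "has_rank (2^n) r F" and r: "r \<le> 2 ^ (8 * c * m)"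
    and close: "\<And>x y. x < 2^n \<Longrightarrow> y < 2^n \<Longrightarrow> \<bar>f x y - F x y\<bar> \<le> 2 * (8/9) ^ m"
    using BQC_low_rank_approx[OF f, of m] c unfolding c_def by metis
  have "(8/9::real) ^ m \<le> 2 powr - (L + 1)"
    by (rule power_le_inverse_powr[of _ 6]) (use m L in \<open>auto simp: power_divide\<close>)
  also have "\<dots> = 2 powr (log 2 \<kappa> - log 2 (sqrt (real k)) - 2)" by (simp add: L_def)
  also have "\<dots> = \<kappa> / sqrt (real k) / 4" using \<kappa>1 sk by (simp add: powr_diff)
  finally have "sqrt (real k) * (2 * (8/9) ^ m) \<le> \<kappa> / 2" using sk by (simp add: field_simps)
  moreover have "\<kappa> \<le> sqrt (real r) + sqrt (real k) * (2 * (8/9) ^ m)"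
    unfolding \<kappa>_def by (rule kappa_le_rank[OF f k(2) F _ close]) auto
  ultimately have "\<kappa> \<le> 2 * sqrt (real r)" by linarith
  also have "sqrt (real r) \<le> sqrt (2 ^ (8 * c * m))"
    using r by (metis of_nat_le_iff of_nat_numeral of_nat_power real_sqrt_le_mono)
  also have "sqrt (2 ^ (8 * c * m)) = (2::real) ^ (4 * c * m)"
  proof -
    have "(2::real) ^ (8 * c * m) = (2 ^ (4 * c * m))\<^sup>2" by (simp add: power_mult[symmetric] mult_ac)
    then show ?thesis by simp
  qed
  finally have "\<kappa> \<le> 2 ^ (4 * c * m + 1)" by simp
  then have "log 2 \<kappa> \<le> log 2 (2 ^ (4 * c * m + 1))"
    using \<kappa>1 by (subst log_le_cancel_iff) auto
  also have "\<dots> = 4 * real c * real m + 1" by (subst log_nat_power) auto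
  \<comment> \<open>The constant 53 is 4 * 13 plus 1, where \<open>real c * L \<ge> 1\<close>
    absorbs the additive 1.\<close>
  also have "\<dots> \<le> 4 * real c * (13 * L) + real c * L"
  proof -
    have "4 * real c * real m \<le> 4 * real c * (13 * L)" using m by (intro mult_left_mono) auto
    moreover have "1 * 1 \<le> real c * L" using c L by (intro mult_mono) auto
    ultimately show ?thesis by linarith
  qed
  also have "\<dots> = 53 * real c * L" by simp
  finally show ?thesis by (simp only: c_def L_def \<kappa>_def)
qed

theorem theorem6p10:
  shows "(\<exists>c>0. \<exists>N. \<forall>n\<ge>N. \<forall>f. boolean_fun n f \<longrightarrow>
            real (BQC n f) \<ge> c * entropy_sv n f / log 2 (real n))
       \<and> (\<forall>a>0. \<exists>c>0. \<exists>N. \<forall>n\<ge>N. \<forall>f k. boolean_fun n f \<and> 1 \<le> k \<and> k \<le> 2^n \<and>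
            kappa n f k \<ge> a * sqrt (real k) \<longrightarrow>
            real (BQC n f) \<ge> c * log 2 (kappa n f k))
       \<and> (\<forall>a>0. \<exists>c>0. \<exists>N. \<forall>n\<ge>N. \<forall>f k. boolean_fun n f \<and> 1 \<le> k \<and> k \<le> 2^n \<and>
            kappa n f k \<le> a * sqrt (real k) \<longrightarrow>
            real (BQC n f) \<ge> c * (log 2 (kappa n f k)
               / (log 2 (sqrt (real k)) - log 2 (kappa n f k) + 1)))"
proof (intro conjI allI impI)
  have "1/40 * entropy_sv n f / log 2 (real n) \<le> real (BQC n f)"
    if n: "n \<ge> 2" and f: "boolean_fun n f" for n f
  proof -
    have "log 2 (real n) > 0" using n by simp
    then show ?thesis using entropy_le_BQC[OF f n] by (simp add: field_simps)
  qed
  then show "\<exists>c>0. \<exists>N. \<forall>n\<ge>N. \<forall>f. boolean_fun n f \<longrightarrow>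
      real (BQC n f) \<ge> c * entropy_sv n f / log 2 (real n)"
    by (intro exI[of _ "1/40"] conjI exI[of _ 2]) auto
next
  fix a :: real assume a: "a > 0"
  \<comment> \<open>In this regime \<open>1 - log 2 a\<close> bounds the denominator
    \<open>log 2 (sqrt (real k)) - log 2 (kappa n f k) + 1\<close>. The maximum with 1 keeps
    \<open>K\<close> positive when \<open>a\<close> is large.\<close>
  define K where "K = max 1 (1 - log 2 a)"
  have "1 / (53 * K) * log 2 (kappa n f k) \<le> real (BQC n f)"
    if f: "boolean_fun n f" and k: "1 \<le> k" "k \<le> 2^n" and ge: "a * sqrt (real k) \<le> kappa n f k" for n f k
  proof (cases "kappa n f k > 1")
    case True
    have sk: "sqrt (real k) > 0" using k by simp
    have "log 2 (a * sqrt (real k)) \<le> log 2 (kappa n f k)"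
      using ge a sk True by (subst log_le_cancel_iff) auto
    then have "log 2 (sqrt (real k)) - log 2 (kappa n f k) + 1 \<le> K"
      using a sk by (simp add: log_mult K_def)
    then have "53 * real (BQC n f) * (log 2 (sqrt (real k)) - log 2 (kappa n f k) + 1)
        \<le> 53 * real (BQC n f) * K" by (intro mult_left_mono) auto
    then have "log 2 (kappa n f k) \<le> 53 * real (BQC n f) * K"
      using log_kappa_le_BQC[OF f k True] by linarith
    moreover have "K > 0" by (simp add: K_def)
    ultimately show ?thesis by (simp add: field_simps)
  next
    case False
    have "kappa n f k > 0" by (rule kappa_pos[OF f k])
    \<comment> \<open>When \<open>kappa\<close> is at most 1 the claimed lower bound is
      nonpositive.\<close>
    then have "log 2 (kappa n f k) \<le> 0" using False by simp
    moreover have "K > 0" by (simp add: K_def)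
    ultimately have "1 / (53 * K) * log 2 (kappa n f k) \<le> 0" by (simp add: divide_nonpos_pos)
    then show ?thesis by linarith
  qed
  moreover have "1 / (53 * K) > 0" by (simp add: K_def)
  ultimately show "\<exists>c>0. \<exists>N. \<forall>n\<ge>N. \<forall>f k. boolean_fun n f \<and> 1 \<le> k \<and> k \<le> 2^n \<and>
      kappa n f k \<ge> a * sqrt (real k) \<longrightarrow> real (BQC n f) \<ge> c * log 2 (kappa n f k)"
    by (intro exI[of _ "1 / (53 * K)"] conjI exI[of _ 0]) auto
next
  fix a :: real assume "a > 0"
  have "1 / 53 * (log 2 (kappa n f k) / (log 2 (sqrt (real k)) - log 2 (kappa n f k) + 1)) \<le> real (BQC n f)"
    if f: "boolean_fun n f" and k: "1 \<le> k" "k \<le> 2^n" for n f k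
  proof -
    have pos: "kappa n f k > 0" by (rule kappa_pos[OF f k])
    define L where "L = log 2 (sqrt (real k)) - log 2 (kappa n f k) + 1"
    \<comment> \<open>The general bound of \<open>kappa\<close> by \<open>sqrt (real k)\<close>
      keeps the denominator positive, so it can be multiplied out.\<close>
    have "log 2 (kappa n f k) \<le> log 2 (sqrt (real k))"
      using kappa_le_sqrt[OF f k(2)] pos k by (subst log_le_cancel_iff) auto
    then have L: "L > 0" by (simp add: L_def)
    have "log 2 (kappa n f k) \<le> 53 * real (BQC n f) * L"
    proof (cases "kappa n f k > 1")
      case True
      then show ?thesis using log_kappa_le_BQC[OF f k] by (simp add: L_def)
    next
      case False
      then have "log 2 (kappa n f k) \<le> 0" using pos by simp
      moreover have "0 \<le> 53 * real (BQC n f) * L" using L by simp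
      ultimately show ?thesis by linarith
    qed
    then show ?thesis using L unfolding L_def[symmetric] by (simp add: field_simps)
  qed
  then show "\<exists>c>0. \<exists>N. \<forall>n\<ge>N. \<forall>f k. boolean_fun n f \<and> 1 \<le> k \<and> k \<le> 2^n \<and>
      kappa n f k \<le> a * sqrt (real k) \<longrightarrow>
      real (BQC n f) \<ge> c * (log 2 (kappa n f k)
        / (log 2 (sqrt (real k)) - log 2 (kappa n f k) + 1))"
    by (intro exI[of _ "1/53"] conjI exI[of _ 0]) auto
qed

end
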